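(* Fix a polynomially bounded o-minimal expansion of $\mathbb{R}$. Let $\mathcal{A}$ be a definable family of subsets of $\mathbb{R}^n$ parametrized by the definable set $A$, and let $\mathcal{B}$ be a definable family of subsets of $\mathbb{R}^{n+1}$ parametrized by the definable set $B$. Then there exists $N = N(\mathcal{A},\mathcal{B}) > 0$ having the following property. For any triple of finite sets $(A',B',B'')$ with $A' \subset A$ and $B',B'' \subset B$, there exists $c \in \mathbb{R}$ (depending on this triple) such that for each closed and bounded $(\mathcal{A},A')$-set $S$, each $(\mathcal{B},B')$-set $F$ and each $(\mathcal{B},B'')$-set $G$ such that $F,G$ are graphs of definable functions $f,g:\mathbb{R}^n \rightarrow \mathbb{R}$ which are continuous on $S$ and satisfy $f|_S^{-1}(0) \subset g|_S^{-1}(0)$, we have for all $x \in S$ \[ |g(x)|^N \leq c \cdot |f(x)|. \]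
   Context: An o-minimal expansion of $\mathbb{R}$ is polynomially bounded if for every definable $h:\mathbb{R}\to\mathbb{R}$ there exist $N\in\mathbb{N}$, $c\in\mathbb{R}$ with $|h(x)|<x^N$ for all $x>c$. A definable family of subsets of $\mathbb{R}^n$ parametrized by a definable set $A$ is a definable subset $\mathcal{A}\subset A\times\mathbb{R}^n$; for $a\in A$, $\mathcal{A}_a=\{y\in\mathbb{R}^n : (a,y)\in\mathcal{A}\}$. For a finite subset $A'\subset A$, an $(\mathcal{A},A')$-set is any subset of $\mathbb{R}^n$ belonging to the Boolean algebra of subsets of $\mathbb{R}^n$ generated by the sets $\mathcal{A}_a$, $a\in A'$. *)

theory Defs
  imports Complex_Main
begin

text \<open>Points of R^n are represented as real lists of length n.
  A structure on R is a family Sig :: nat => real list set set, Sig n being the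
  definable subsets of R^n (definable with parameters).\<close>

definition Rn :: "nat \<Rightarrow> real list set" where
  "Rn n = {x. length x = n}"

definition is_structure :: "(nat \<Rightarrow> real list set set) \<Rightarrow> bool" where
  "is_structure Sig \<longleftrightarrow>
     (\<forall>n. Sig n \<subseteq> Pow (Rn n)) \<and>
     (\<forall>n. {} \<in> Sig n) \<and>
     (\<forall>n. \<forall>X\<in>Sig n. Rn n - X \<in> Sig n) \<and>
     (\<forall>n. \<forall>X\<in>Sig n. \<forall>Y\<in>Sig n. X \<union> Y \<in> Sig n) \<and>
     (\<forall>n. \<forall>X\<in>Sig n. {r # x | r x. x \<in> X} \<in> Sig (Suc n)) \<and>
     (\<forall>n. \<forall>X\<in>Sig n. {x @ [r] | x r. x \<in> X} \<in> Sig (Suc n)) \<and>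
     (\<forall>n i j. i < j \<and> j < n \<longrightarrow> {x \<in> Rn n. x ! i = x ! j} \<in> Sig n) \<and>
     (\<forall>n. \<forall>X\<in>Sig (Suc n). butlast ` X \<in> Sig n)"

definition expands_real_field :: "(nat \<Rightarrow> real list set set) \<Rightarrow> bool" where
  "expands_real_field Sig \<longleftrightarrow>
     {[x, y] | x y. x < y} \<in> Sig 2 \<and>
     {[x, y, x + y] | x y. True} \<in> Sig 3 \<and>
     {[x, y, x * y] | x y. True} \<in> Sig 3 \<and>
     (\<forall>r. {[r]} \<in> Sig 1)"

definition interval_or_point :: "real set \<Rightarrow> bool" where
  "interval_or_point I \<longleftrightarrow>
     (\<exists>a. I = {a}) \<or> (\<exists>a b. I = {a<..<b}) \<or> (\<exists>a. I = {a<..}) \<or>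
     (\<exists>b. I = {..<b}) \<or> I = UNIV"

definition o_minimal_expansion :: "(nat \<Rightarrow> real list set set) \<Rightarrow> bool" where
  "o_minimal_expansion Sig \<longleftrightarrow>
     is_structure Sig \<and> expands_real_field Sig \<and>
     (\<forall>X\<in>Sig 1. \<exists>U. finite U \<and> (\<forall>I\<in>U. interval_or_point I) \<and>
                   X = (\<lambda>r. [r]) ` \<Union>U)"

definition definable_fun1 :: "(nat \<Rightarrow> real list set set) \<Rightarrow> (real \<Rightarrow> real) \<Rightarrow> bool" where
  "definable_fun1 Sig h \<longleftrightarrow> {[x, h x] | x. True} \<in> Sig 2"

definition polynomially_bounded :: "(nat \<Rightarrow> real list set set) \<Rightarrow> bool" where
  "polynomially_bounded Sig \<longleftrightarrow>
     (\<forall>h. definable_fun1 Sig h \<longrightarrow> (\<exists>(N::nat) c. \<forall>x>c. \<bar>h x\<bar> < x ^ N))"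

definition graph_on :: "nat \<Rightarrow> (real list \<Rightarrow> real) \<Rightarrow> real list set" where
  "graph_on n f = {x @ [f x] | x. x \<in> Rn n}"

definition definable_fun :: "(nat \<Rightarrow> real list set set) \<Rightarrow> nat \<Rightarrow> (real list \<Rightarrow> real) \<Rightarrow> bool" where
  "definable_fun Sig n f \<longleftrightarrow> graph_on n f \<in> Sig (Suc n)"

definition definable_family ::
  "(nat \<Rightarrow> real list set set) \<Rightarrow> nat \<Rightarrow> nat \<Rightarrow> real list set \<Rightarrow> real list set \<Rightarrow> bool" where
  "definable_family Sig m n P Fam \<longleftrightarrow>
     P \<in> Sig m \<and> Fam \<in> Sig (m + n) \<and> Fam \<subseteq> {a @ y | a y. a \<in> P \<and> y \<in> Rn n}"

definition fibre :: "real list set \<Rightarrow> real list \<Rightarrow> real list set" where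
  "fibre Fam a = {y. a @ y \<in> Fam}"

inductive_set bool_alg :: "nat \<Rightarrow> real list set set \<Rightarrow> real list set set"
  for n :: nat and C :: "real list set set" where
  gen: "X \<in> C \<Longrightarrow> X \<in> bool_alg n C"
| empty: "{} \<in> bool_alg n C"
| compl: "X \<in> bool_alg n C \<Longrightarrow> Rn n - X \<in> bool_alg n C"
| union: "X \<in> bool_alg n C \<Longrightarrow> Y \<in> bool_alg n C \<Longrightarrow> X \<union> Y \<in> bool_alg n C"

definition fam_set :: "nat \<Rightarrow> real list set \<Rightarrow> real list set \<Rightarrow> real list set \<Rightarrow> bool" where
  "fam_set n Fam P' X \<longleftrightarrow> X \<in> bool_alg n (fibre Fam ` P')"

definition closed_Rn :: "nat \<Rightarrow> real list set \<Rightarrow> bool" where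
  "closed_Rn n S \<longleftrightarrow> S \<subseteq> Rn n \<and>
     (\<forall>X y. (\<forall>k. X k \<in> S) \<and> y \<in> Rn n \<and> (\<forall>i<n. (\<lambda>k. X k ! i) \<longlonglongrightarrow> y ! i) \<longrightarrow> y \<in> S)"

definition bounded_Rn :: "nat \<Rightarrow> real list set \<Rightarrow> bool" where
  "bounded_Rn n S \<longleftrightarrow> (\<exists>M. \<forall>x\<in>S. \<forall>i<n. \<bar>x ! i\<bar> \<le> M)"

definition continuous_on_Rn :: "nat \<Rightarrow> real list set \<Rightarrow> (real list \<Rightarrow> real) \<Rightarrow> bool" where
  "continuous_on_Rn n S f \<longleftrightarrow>
     (\<forall>x\<in>S. \<forall>e>0. \<exists>d>0. \<forall>y\<in>S. (\<forall>i<n. \<bar>y ! i - x ! i\<bar> < d) \<longrightarrow> \<bar>f y - f x\<bar> < e)"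

end

theory Submission
  imports Defs "HOL-Analysis.Analysis"
begin

text \<open>Uniform finiteness holds because the points of a line near which a finite definable fibre
  fails to vary continuously form a definable countable set, hence a finite one; induction on the
  number of parameters follows. Consequently all sets of the Boolean algebra generated by any
  finite number of fibres are unions of cells that are fibres of one fixed definable family, and
  along three such cells \<open>(f x, g x)\<close> runs through a member of one definable family of plane
  sets. For those sets the reciprocal of \<open>inf {|f| : |g| \<ge> 1/s}\<close> is an increasing function of
  \<open>s\<close>, positive by compactness of \<open>S\<close>. The growth exponents of such a definable family are
  bounded: otherwise the limits of \<open>h (\<mu> s) / h s\<close> would produce a definable function growing
  like \<open>\<mu>\<close> to the power \<open>log \<mu>\<close>.\<close>

section \<open>Definable predicates and terms\<close>

text \<open>The obstacle is that \<open>N\<close> must not depend on how many parameters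
  \<open>A'\<close>, \<open>B'\<close>, \<open>B''\<close> contain, although a set of the Boolean
  algebra may involve all of them. The inequality is pointwise: at a given \<open>x\<close> only one
  cell each of \<open>S\<close>, \<open>F\<close> and \<open>G\<close> through that point matters,
  and such a triple has a fixed number of parameters. The sizes of the finite sets affect only the
  number of triples, hence only \<open>c\<close>, which is a maximum over them. The cells need not
  be closed, so compactness of \<open>S\<close> enters only through two consequences that pass to
  subsets: |g| is bounded, and |f| is bounded away from 0 wherever |g| is at least a given t >
  0.\<close>

locale real_structure =
  fixes Sig :: "nat \<Rightarrow> real list set set"
  assumes is_struct: "is_structure Sig"
    and real_field: "expands_real_field Sig"
begin

section \<open>Definable sets under padding, projection and change of coordinates\<close>

lemmas struct_axioms = is_struct[unfolded is_structure_def]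

lemma Sig_length: "X \<in> Sig n \<Longrightarrow> x \<in> X \<Longrightarrow> length x = n"
  using struct_axioms[THEN conjunct1] unfolding Rn_def by blast

lemma Sig_empty: "{} \<in> Sig n"
  using struct_axioms[THEN conjunct2, THEN conjunct1] by blast

lemma Sig_compl: "X \<in> Sig n \<Longrightarrow> Rn n - X \<in> Sig n"
  using struct_axioms[THEN conjunct2, THEN conjunct2, THEN conjunct1] by blast

lemma Sig_union: "X \<in> Sig n \<Longrightarrow> Y \<in> Sig n \<Longrightarrow> X \<union> Y \<in> Sig n"
  using struct_axioms[THEN conjunct2, THEN conjunct2, THEN conjunct2, THEN conjunct1] by blast

lemma Sig_Cons: "X \<in> Sig n \<Longrightarrow> {r # x | r x. x \<in> X} \<in> Sig (Suc n)"
  using struct_axioms[THEN conjunct2, THEN conjunct2, THEN conjunct2, THEN conjunct2, THEN conjunct1] by blast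

lemma Sig_diag: "i < j \<Longrightarrow> j < n \<Longrightarrow> {x \<in> Rn n. x ! i = x ! j} \<in> Sig n"
  using struct_axioms[THEN conjunct2, THEN conjunct2, THEN conjunct2, THEN conjunct2, THEN conjunct2, THEN conjunct2, THEN conjunct1] by blast

lemma Sig_butlast: "X \<in> Sig (Suc n) \<Longrightarrow> butlast ` X \<in> Sig n"
  using struct_axioms[THEN conjunct2, THEN conjunct2, THEN conjunct2, THEN conjunct2, THEN conjunct2, THEN conjunct2, THEN conjunct2] by blast

lemma Sig_Rn: "Rn n \<in> Sig n"
  using Sig_compl[OF Sig_empty, of n] by simp

lemma Sig_inter:
  assumes X: "X \<in> Sig n" and Y: "Y \<in> Sig n"
  shows "X \<inter> Y \<in> Sig n"
proof -
  have "X \<inter> Y = Rn n - ((Rn n - X) \<union> (Rn n - Y))"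
    using Sig_length[OF X] by (auto simp: Rn_def)
  then show ?thesis using X Y by (simp add: Sig_compl Sig_union)
qed

lemma Sig_prepend: "X \<in> Sig k \<Longrightarrow> {y @ x | y x. y \<in> Rn M \<and> x \<in> X} \<in> Sig (M + k)"
proof (induction M)
  case 0
  have "{y @ x | y x. y \<in> Rn 0 \<and> x \<in> X} = X" by (auto simp: Rn_def)
  then show ?case using 0 by simp
next
  case (Suc M)
  have "{y @ x | y x. y \<in> Rn (Suc M) \<and> x \<in> X}
      = {r # z | r z. z \<in> {y @ x | y x. y \<in> Rn M \<and> x \<in> X}}" (is "?L = ?R")
  proof
    show "?L \<subseteq> ?R"
      by (auto simp: Rn_def length_Suc_conv) blast
    show "?R \<subseteq> ?L"
    proof
      fix w assume "w \<in> ?R"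
      then obtain r y x where "w = r # y @ x" "y \<in> Rn M" "x \<in> X" by blast
      then have "w = (r # y) @ x" "r # y \<in> Rn (Suc M)" "x \<in> X" by (auto simp: Rn_def)
      then show "w \<in> ?L" by blast
    qed
  qed
  then show ?case using Sig_Cons[OF Suc.IH[OF Suc.prems]] by simp
qed

lemma Sig_take: "X \<in> Sig (M + k) \<Longrightarrow> take M ` X \<in> Sig M"
proof (induction k arbitrary: X)
  case 0
  then have "take M ` X = X" using Sig_length[OF 0] by (force simp: image_iff)
  then show ?case using 0 by simp
next
  case (Suc k)
  have "butlast ` X \<in> Sig (M + k)" using Suc.prems Sig_butlast by simp
  then have "take M ` butlast ` X \<in> Sig M" by (rule Suc.IH)
  moreover have "take M (butlast x) = take M x" if "x \<in> X" for x
    using Sig_length[OF Suc.prems that] by (simp add: butlast_conv_take)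
  then have "take M ` butlast ` X = take M ` X" by (force simp: image_iff)
  ultimately show ?case by simp
qed

text \<open>The graph of the coordinate map is cut out of the product of \<open>Rn M\<close> and
  \<open>X\<close> by the diagonals \<open>z ! \<sigma> i = z ! (M + i)\<close> and then projected
  to its first \<open>M\<close> coordinates. Since \<open>\<sigma> i < M\<close>, each diagonal has
  its smaller index first, as \<open>Sig_diag\<close> demands.\<close>

lemma Sig_reindex:
  assumes X: "X \<in> Sig k" and \<sigma>: "\<And>i. i < k \<Longrightarrow> \<sigma> i < M"
  shows "{x \<in> Rn M. map (\<lambda>i. x ! \<sigma> i) [0..<k] \<in> X} \<in> Sig M"
proof -
  define W where "W j = {y @ x | y x. y \<in> Rn M \<and> x \<in> X} \<inter>
      {z \<in> Rn (M + k). \<forall>i<j. z ! \<sigma> i = z ! (M + i)}" for j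
  have "W j \<in> Sig (M + k)" if "j \<le> k" for j
    using that
  proof (induction j)
    case 0
    then show ?case using Sig_inter[OF Sig_prepend[OF X] Sig_Rn] by (simp add: W_def)
  next
    case (Suc j)
    have "W (Suc j) = W j \<inter> {z \<in> Rn (M + k). z ! \<sigma> j = z ! (M + j)}"
      by (auto simp: W_def less_Suc_eq)
    moreover have "{z \<in> Rn (M + k). z ! \<sigma> j = z ! (M + j)} \<in> Sig (M + k)"
      using Suc.prems \<sigma>[of j] by (intro Sig_diag) auto
    ultimately show ?case using Suc Sig_inter by simp
  qed
  then have "take M ` W k \<in> Sig M" using Sig_take by blast
  moreover have "take M ` W k = {x \<in> Rn M. map (\<lambda>i. x ! \<sigma> i) [0..<k] \<in> X}" (is "_ = ?R")
  proof
    show "take M ` W k \<subseteq> ?R"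
    proof
      fix w assume "w \<in> take M ` W k"
      then obtain y x where yx: "w = take M (y @ x)" "y \<in> Rn M" "x \<in> X"
        and eq: "\<forall>i<k. (y @ x) ! \<sigma> i = (y @ x) ! (M + i)"
        unfolding W_def by blast
      have "map (\<lambda>i. y ! \<sigma> i) [0..<k] = x"
        using yx eq \<sigma> Sig_length[OF X yx(3)]
        by (intro nth_equalityI) (auto simp: Rn_def nth_append)
      then show "w \<in> ?R" using yx by (auto simp: Rn_def)
    qed
    show "?R \<subseteq> take M ` W k"
    proof
      fix y assume y: "y \<in> ?R"
      define x where "x = map (\<lambda>i. y ! \<sigma> i) [0..<k]"
      have "y @ x \<in> W k" using y \<sigma> by (auto simp: W_def x_def Rn_def nth_append)
      moreover have "take M (y @ x) = y" using y by (simp add: Rn_def)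
      ultimately show "y \<in> take M ` W k" by (metis image_eqI)
    qed
  qed
  ultimately show ?thesis by simp
qed

text \<open>Formulas are shallowly embedded as predicates on assignments of the variables
  \<^term>\<open>v 0\<close>, \<^term>\<open>v 1\<close>, and so on; binders use de Bruijn indices.\<close>

definition dpred :: "((nat \<Rightarrow> real) \<Rightarrow> bool) \<Rightarrow> bool" where
  "dpred P \<longleftrightarrow> (\<exists>k. \<exists>X\<in>Sig k. \<forall>v. P v \<longleftrightarrow> map v [0..<k] \<in> X)"

definition dterm :: "((nat \<Rightarrow> real) \<Rightarrow> real) \<Rightarrow> bool" where
  "dterm t \<longleftrightarrow> dpred (\<lambda>v. v 0 = t (\<lambda>i. v (Suc i)))"

definition dvec :: "nat \<Rightarrow> ((nat \<Rightarrow> real) \<Rightarrow> real list) \<Rightarrow> bool" where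
  "dvec n t \<longleftrightarrow> (\<forall>v. length (t v) = n) \<and> (\<forall>i<n. dterm (\<lambda>v. t v ! i))"

section \<open>Connectives, quantifiers and substitution for definable predicates\<close>

lemma dpredI: "X \<in> Sig k \<Longrightarrow> (\<And>v. P v \<longleftrightarrow> map v [0..<k] \<in> X) \<Longrightarrow> dpred P"
  unfolding dpred_def by (intro exI[of _ k] bexI[of _ X]) simp_all

lemma dpredE:
  assumes "dpred P"
  obtains k X where "X \<in> Sig k" "\<And>v. P v \<longleftrightarrow> map v [0..<k] \<in> X"
  using assms unfolding dpred_def by (elim exE bexE) simp

lemma dpred_reindex:
  assumes "dpred P"
  shows "dpred (\<lambda>v. P (\<lambda>i. v (\<sigma> i)))"
proof -
  obtain k X where X: "X \<in> Sig k" "\<And>v. P v \<longleftrightarrow> map v [0..<k] \<in> X"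
    using assms by (elim dpredE) (rule that)
  define M where "M = Suc (Max (insert 0 (\<sigma> ` {..<k})))"
  have \<sigma>: "\<sigma> i < M" if "i < k" for i
    using that by (simp add: M_def less_Suc_eq_le)
  have "P (\<lambda>i. v (\<sigma> i)) \<longleftrightarrow>
      map v [0..<M] \<in> {x \<in> Rn M. map (\<lambda>i. x ! \<sigma> i) [0..<k] \<in> X}" for v
  proof -
    have "map (\<lambda>i. map v [0..<M] ! \<sigma> i) [0..<k] = map (\<lambda>i. v (\<sigma> i)) [0..<k]"
      using \<sigma> by simp
    then show ?thesis unfolding X(2) mem_Collect_eq by (simp only:) (simp add: Rn_def)
  qed
  from dpredI[OF Sig_reindex[OF X(1) \<sigma>] this] show ?thesis .
qed

lemma dpred_mem_map: "X \<in> Sig k \<Longrightarrow> dpred (\<lambda>v. map (\<lambda>i. v (\<sigma> i)) [0..<k] \<in> X)"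
  by (rule dpred_reindex[of "\<lambda>v. map v [0..<k] \<in> X" \<sigma>]) (rule dpredI, simp_all)

lemma dpred_neg: "dpred P \<Longrightarrow> dpred (\<lambda>v. \<not> P v)"
  by (elim dpredE, rule dpredI, erule Sig_compl) (simp add: Rn_def)

lemma Sig_pad: "X \<in> Sig k \<Longrightarrow> {x \<in> Rn (k + l). take k x \<in> X} \<in> Sig (k + l)"
proof -
  assume X: "X \<in> Sig k"
  have "map (\<lambda>i. x ! i) [0..<k] = take k x" if "x \<in> Rn (k + l)" for x
    using that by (intro nth_equalityI) (auto simp: Rn_def)
  then have "{x \<in> Rn (k + l). take k x \<in> X} = {x \<in> Rn (k + l). map (\<lambda>i. x ! i) [0..<k] \<in> X}"
    by auto
  then show ?thesis using Sig_reindex[OF X, of "\<lambda>i. i" "k + l"] by simp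
qed

lemma dpred_conj:
  assumes "dpred P" "dpred Q"
  shows "dpred (\<lambda>v. P v \<and> Q v)"
proof -
  obtain k X l Y where X: "X \<in> Sig k" "\<And>v. P v \<longleftrightarrow> map v [0..<k] \<in> X"
    and Y: "Y \<in> Sig l" "\<And>v. Q v \<longleftrightarrow> map v [0..<l] \<in> Y"
    using assms by (elim dpredE) (rule that)
  let ?Z = "{x \<in> Rn (k + l). take k x \<in> X} \<inter> {x \<in> Rn (l + k). take l x \<in> Y}"
  have "?Z \<in> Sig (k + l)"
    using Sig_pad[OF Y(1), of k] by (intro Sig_inter Sig_pad X(1)) (simp add: add.commute)
  moreover have "P v \<and> Q v \<longleftrightarrow> map v [0..<k + l] \<in> ?Z" for v
    by (simp add: X Y Rn_def take_map)
  ultimately show ?thesis by (rule dpredI)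
qed

lemma disj_conv_conj_neg: "P \<or> Q \<longleftrightarrow> \<not> (\<not> P \<and> \<not> Q)"
  by simp

lemma dpred_disj: "dpred P \<Longrightarrow> dpred Q \<Longrightarrow> dpred (\<lambda>v. P v \<or> Q v)"
  unfolding disj_conv_conj_neg by (intro dpred_neg dpred_conj)

lemma dpred_imp: "dpred P \<Longrightarrow> dpred Q \<Longrightarrow> dpred (\<lambda>v. P v \<longrightarrow> Q v)"
  unfolding imp_conv_disj by (intro dpred_disj dpred_neg)

lemma dpred_const: "dpred (\<lambda>v. b)"
proof -
  have "map v [0..<0] \<in> Rn 0" "map v [0..<0] \<notin> {}" for v :: "nat \<Rightarrow> real"
    by (auto simp: Rn_def)
  then show ?thesis using dpredI[OF Sig_Rn[of 0]] dpredI[OF Sig_empty[of 0]] by (cases b) auto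
qed

lemma dpred_ex:
  assumes "dpred (\<lambda>v. P (\<lambda>i. v (Suc i)) (v 0))"
  shows "dpred (\<lambda>v. \<exists>r. P v r)"
proof -
  obtain k X where X: "X \<in> Sig k" "\<And>v. P (\<lambda>i. v (Suc i)) (v 0) \<longleftrightarrow> map v [0..<k] \<in> X"
    using assms by (elim dpredE) (rule that)
  \<comment> \<open>The bound variable is number 0, whereas the projection axiom removes the last
    coordinate; \<open>\<sigma>\<close> sends variable 0 to position \<open>k\<close>.\<close>
  define \<sigma> where "\<sigma> i = (case i of 0 \<Rightarrow> k | Suc j \<Rightarrow> j)" for i
  define Z where "Z = {x \<in> Rn (Suc k). map (\<lambda>i. x ! \<sigma> i) [0..<k] \<in> X}"
  have Z: "Z \<in> Sig (Suc k)"
    unfolding Z_def by (rule Sig_reindex[OF X(1)]) (auto simp: \<sigma>_def split: nat.splits)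
  have *: "P v r \<longleftrightarrow> map v [0..<k] @ [r] \<in> Z" for v r
  proof -
    have "map (\<lambda>i. (map v [0..<k] @ [r]) ! \<sigma> i) [0..<k] = map (case_nat r v) [0..<k]"
      by (rule map_cong) (auto simp: \<sigma>_def nth_append split: nat.splits)
    then show ?thesis using X(2)[of "case_nat r v"] unfolding Z_def mem_Collect_eq
      by (simp only:) (simp add: Rn_def)
  qed
  have "(\<exists>r. P v r) \<longleftrightarrow> map v [0..<k] \<in> butlast ` Z" for v
  proof
    assume "\<exists>r. P v r"
    then show "map v [0..<k] \<in> butlast ` Z" using * by (metis butlast_snoc imageI)
  next
    assume "map v [0..<k] \<in> butlast ` Z"
    then obtain z where z: "z \<in> Z" "map v [0..<k] = butlast z" by blast
    then have "z \<noteq> []" using Sig_length[OF Z z(1)] by auto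
    then have "z = map v [0..<k] @ [last z]" using z(2) by simp
    then show "\<exists>r. P v r" using * z(1) by metis
  qed
  from dpredI[OF Sig_butlast[OF Z] this] show ?thesis .
qed

lemma all_conv_neg_ex: "(\<forall>r. P r) \<longleftrightarrow> \<not> (\<exists>r. \<not> P r)"
  by simp

lemma dpred_all: "dpred (\<lambda>v. P (\<lambda>i. v (Suc i)) (v 0)) \<Longrightarrow> dpred (\<lambda>v. \<forall>r. P v r)"
  unfolding all_conv_neg_ex by (intro dpred_neg dpred_ex)

lemma dpred_eq_var: "dpred (\<lambda>v. v i = v j)"
proof (cases "i = j")
  case True
  then show ?thesis by (simp add: dpred_const)
next
  case False
  have "dpred (\<lambda>v. v 0 = v (Suc 0))"
    by (rule dpredI[OF Sig_diag[of 0 1 2]]) (auto simp: Rn_def)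
  from dpred_reindex[OF this, of "\<lambda>k. if k = 0 then i else j"] show ?thesis by simp
qed

lemma dterm_var: "dterm (\<lambda>v. v i)"
  unfolding dterm_def by (rule dpred_eq_var)

lemma dterm_reindex: "dterm t \<Longrightarrow> dterm (\<lambda>v. t (\<lambda>i. v (\<sigma> i)))"
  unfolding dterm_def
  using dpred_reindex[of "\<lambda>v. v 0 = t (\<lambda>i. v (Suc i))" "case_nat 0 (\<lambda>i. Suc (\<sigma> i))"] by simp

lemma dpred_term:
  assumes "dpred (\<lambda>v. P (\<lambda>i. v (Suc i)) (v 0))" "dterm t"
  shows "dpred (\<lambda>v. P v (t v))"
  using dpred_ex[OF dpred_conj[OF assms(2)[unfolded dterm_def] assms(1)]] by simp

lemma dpred_eq_term: "dterm t \<Longrightarrow> dpred (\<lambda>v. v i = t (\<lambda>j. v (\<sigma> j)))"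
  unfolding dterm_def
  using dpred_reindex[of "\<lambda>v. v 0 = t (\<lambda>i. v (Suc i))" "case_nat i \<sigma>"] by simp

lemma dpred_ball_less: "(\<And>i. i < (n::nat) \<Longrightarrow> dpred (P i)) \<Longrightarrow> dpred (\<lambda>v. \<forall>i<n. P i v)"
proof (induction n)
  case 0
  then show ?case by (simp add: dpred_const)
next
  case (Suc n)
  have "dpred (\<lambda>v. (\<forall>i<n. P i v) \<and> P n v)" using Suc by (intro dpred_conj) auto
  moreover have "(\<forall>i<n. P i v) \<and> P n v \<longleftrightarrow> (\<forall>i<Suc n. P i v)" for v
    by (auto simp: less_Suc_eq)
  ultimately show ?case by simp
qed

lemma bex_less_conv_neg: "(\<exists>i<(n::nat). P i) \<longleftrightarrow> \<not> (\<forall>i<n. \<not> P i)"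
  by simp

lemma dpred_bex_less: "(\<And>i. i < (n::nat) \<Longrightarrow> dpred (P i)) \<Longrightarrow> dpred (\<lambda>v. \<exists>i<n. P i v)"
  unfolding bex_less_conv_neg by (intro dpred_neg dpred_ball_less)

lemma dpred_bex_Rn:
  "dpred (\<lambda>v. P (\<lambda>i. v (n + i)) (map v [0..<n])) \<Longrightarrow> dpred (\<lambda>v. \<exists>y\<in>Rn n. P v y)"
proof (induction n arbitrary: P)
  case 0
  then show ?case by (simp add: Rn_def)
next
  case (Suc n)
  have "dpred (\<lambda>v. \<exists>y\<in>Rn n. \<exists>r. P v (y @ [r]))"
  proof (rule Suc.IH, rule dpred_ex)
    \<comment> \<open>A rotation of the first \<open>Suc n\<close> variables: the scalar bound
      innermost is variable 0 but has to become the last entry of the vector.\<close>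
    let ?\<sigma> = "\<lambda>i. if i < n then Suc i else if i = n then 0 else i"
    have eq: "map (\<lambda>i. v (?\<sigma> i)) [0..<Suc n] = map (\<lambda>i. v (Suc i)) [0..<n] @ [v 0]"
      for v :: "nat \<Rightarrow> real" by simp
    show "dpred (\<lambda>v. P (\<lambda>i. v (Suc (n + i))) (map (\<lambda>i. v (Suc i)) [0..<n] @ [v 0]))"
      using dpred_reindex[OF Suc.prems, of ?\<sigma>] unfolding eq by simp
  qed
  moreover have "(\<exists>y\<in>Rn n. \<exists>r. P v (y @ [r])) \<longleftrightarrow> (\<exists>y\<in>Rn (Suc n). P v y)" for v
    by (auto simp: Rn_def length_Suc_conv_rev)
  ultimately show ?case by simp
qed

text \<open>Substitution is reduced to quantification: a point \<open>y\<close> of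
  \<open>Rn n\<close> is equated coordinatewise with \<open>t v\<close>, and membership is asked of
  \<open>y\<close>.\<close>

lemma dpred_mem:
  assumes X: "X \<in> Sig n" and t: "dvec n t"
  shows "dpred (\<lambda>v. t v \<in> X)"
proof -
  have "dpred (\<lambda>v. \<exists>y\<in>Rn n. (\<forall>i<n. y ! i = t v ! i) \<and> y \<in> X)"
  proof (intro dpred_bex_Rn dpred_conj dpred_ball_less)
    fix i assume "i < n"
    then show "dpred (\<lambda>v. map v [0..<n] ! i = t (\<lambda>i. v (n + i)) ! i)"
      using t dpred_eq_term[of "\<lambda>v. t v ! i" i "\<lambda>i. n + i"] by (simp add: dvec_def)
  qed (use dpred_mem_map[OF X, of "\<lambda>i. i"] in simp)
  moreover have "(\<exists>y\<in>Rn n. (\<forall>i<n. y ! i = t v ! i) \<and> y \<in> X) \<longleftrightarrow> t v \<in> X" for v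
  proof -
    have "length (t v) = n" using t by (simp add: dvec_def)
    then have "t v = y" if "y \<in> Rn n" "\<forall>i<n. y ! i = t v ! i" for y
      using that by (intro nth_equalityI) (auto simp: Rn_def)
    moreover have "t v \<in> Rn n" using \<open>length (t v) = n\<close> by (simp add: Rn_def)
    ultimately show ?thesis by auto
  qed
  ultimately show ?thesis by simp
qed

lemma dpred_subst:
  assumes "dpred Q" "\<And>i. dterm (\<tau> i)"
  shows "dpred (\<lambda>v. Q (\<lambda>i. \<tau> i v))"
proof -
  obtain k X where X: "X \<in> Sig k" "\<And>v. Q v \<longleftrightarrow> map v [0..<k] \<in> X"
    using assms(1) by (elim dpredE) (rule that)
  have "dvec k (\<lambda>v. map (\<lambda>i. \<tau> i v) [0..<k])" using assms(2) by (simp add: dvec_def)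
  from dpred_mem[OF X(1) this] show ?thesis by (simp add: X(2))
qed

lemma dterm_subst:
  assumes "dterm T" "\<And>i. dterm (\<tau> i)"
  shows "dterm (\<lambda>v. T (\<lambda>i. \<tau> i v))"
proof -
  define \<tau>' where "\<tau>' = case_nat (\<lambda>v. v 0) (\<lambda>i v. \<tau> i (\<lambda>j. v (Suc j)))"
  have "dterm (\<tau>' i)" for i
    unfolding \<tau>'_def by (cases i) (simp_all add: dterm_var dterm_reindex assms(2))
  from dpred_subst[OF assms(1)[unfolded dterm_def], of \<tau>', OF this] show ?thesis
    unfolding dterm_def by (simp add: \<tau>'_def)
qed

text \<open>The witness of \<open>dpred\<close> may use any number \<open>k\<close> of variables, so
  the comparison takes place in \<open>Rn (n + k)\<close> and is projected back. Padding by zeros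
  does no harm because \<open>Q\<close> sees only the first \<open>n\<close> entries.\<close>

lemma Sig_Collect:
  assumes "dpred (\<lambda>v. Q (map v [0..<n]))"
  shows "{x \<in> Rn n. Q x} \<in> Sig n"
proof -
  obtain k X where X: "X \<in> Sig k" "\<And>v. Q (map v [0..<n]) \<longleftrightarrow> map v [0..<k] \<in> X"
    using assms by (elim dpredE) (rule that)
  have "{x \<in> Rn n. Q x} = take n ` {x \<in> Rn (n + k). take k x \<in> X}" (is "_ = ?R")
  proof
    show "{x \<in> Rn n. Q x} \<subseteq> ?R"
    proof
      fix x assume x: "x \<in> {x \<in> Rn n. Q x}"
      define y where "y = x @ replicate k 0"
      have "map (\<lambda>i. y ! i) [0..<n] = x" "map (\<lambda>i. y ! i) [0..<k] = take k y"
        using x by (auto simp: y_def Rn_def nth_append intro!: nth_equalityI)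
      then have "take k y \<in> X" using x X(2)[of "\<lambda>i. y ! i"] by simp
      then show "x \<in> ?R" using x by (auto simp: image_iff y_def Rn_def intro!: exI[of _ y])
    qed
    show "?R \<subseteq> {x \<in> Rn n. Q x}"
    proof
      fix x assume "x \<in> ?R"
      then obtain y where y: "x = take n y" "y \<in> Rn (n + k)" "take k y \<in> X" by blast
      have "map (\<lambda>i. y ! i) [0..<n] = x" "map (\<lambda>i. y ! i) [0..<k] = take k y"
        using y by (auto simp: Rn_def intro!: nth_equalityI)
      then show "x \<in> {x \<in> Rn n. Q x}" using y X(2)[of "\<lambda>i. y ! i"] by (simp add: Rn_def)
    qed
  qed
  moreover have "{x \<in> Rn (n + k). take k x \<in> X} \<in> Sig (n + k)"
    using Sig_pad[OF X(1), of n] by (simp add: add.commute)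
  ultimately show ?thesis using Sig_take by simp
qed

section \<open>Order and arithmetic on definable terms\<close>

lemma field_axioms:
  "{[x, y] | x y. x < y} \<in> Sig 2"
  "{[x, y, x + y] | x y. True} \<in> Sig 3"
  "{[x, y, x * y] | x y. True} \<in> Sig 3"
  "{[r]} \<in> Sig 1"
  using real_field unfolding expands_real_field_def by simp_all

lemma dpred_less:
  assumes "dterm t" "dterm s"
  shows "dpred (\<lambda>v. t v < s v)"
proof -
  have "dpred (\<lambda>v. v 0 < v (Suc 0))"
    by (rule dpredI[OF field_axioms(1)]) (auto simp: numeral_2_eq_2)
  from dpred_subst[OF this, of "\<lambda>i. if i = 0 then t else s"] show ?thesis
    using assms by simp
qed

lemma dpred_eq:
  assumes "dterm t" "dterm s"
  shows "dpred (\<lambda>v. t v = s v)"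
  using dpred_subst[OF dpred_eq_var[of 0 1], of "\<lambda>i. if i = 0 then t else s"] assms by simp

lemma dpred_le:
  assumes "dterm t" "dterm s"
  shows "dpred (\<lambda>v. t v \<le> s v)"
  unfolding not_less[symmetric] by (intro dpred_neg dpred_less assms)

lemma dterm_const: "dterm (\<lambda>v. c)"
  unfolding dterm_def by (rule dpredI[OF field_axioms(4)]) auto

lemma dterm_shift: "dterm t \<Longrightarrow> dterm (\<lambda>v. t (\<lambda>i. v (Suc i)))"
  by (rule dterm_reindex)

lemma dterm_binop:
  assumes "{[x, y, f x y] | x y. True} \<in> Sig 3" "dterm t" "dterm s"
  shows "dterm (\<lambda>v. f (t v) (s v))"
proof -
  have *: "dpred (\<lambda>v. v 2 = f (v 0) (v 1))"
    by (rule dpredI[OF assms(1)]) (auto simp: numeral_3_eq_3 numeral_2_eq_2)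
  have "dterm (if i = 0 then \<lambda>v. t (\<lambda>i. v (Suc i)) else if i = 1 then \<lambda>v. s (\<lambda>i. v (Suc i))
      else (\<lambda>v. v 0))" for i :: nat
    using assms by (simp add: dterm_shift dterm_var)
  from dpred_subst[OF *, of "\<lambda>i. if i = 0 then \<lambda>v. t (\<lambda>i. v (Suc i)) else
      if i = 1 then \<lambda>v. s (\<lambda>i. v (Suc i)) else (\<lambda>v. v 0)", OF this]
  show ?thesis unfolding dterm_def by simp
qed

lemmas dterm_add = dterm_binop[OF field_axioms(2)]
lemmas dterm_mult = dterm_binop[OF field_axioms(3)]

lemma dterm_diff:
  assumes "dterm t" "dterm s"
  shows "dterm (\<lambda>v. t v - s v)"
  unfolding dterm_def eq_diff_eq
  by (intro dpred_eq dterm_add dterm_var dterm_shift assms)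

lemma dterm_abs:
  assumes "dterm t"
  shows "dterm (\<lambda>v. \<bar>t v\<bar>)"
proof -
  have *: "x = \<bar>y\<bar> \<longleftrightarrow> (0 \<le> y \<and> x = y) \<or> (y < 0 \<and> x = 0 - y)" for x y :: real by auto
  show ?thesis unfolding dterm_def *
    by (intro dpred_disj dpred_conj dpred_eq dpred_le dpred_less dterm_diff dterm_const
        dterm_var dterm_shift assms)
qed

lemma dterm_divide:
  assumes "dterm t" "dterm s"
  shows "dterm (\<lambda>v. t v / s v)"
proof -
  \<comment> \<open>By convention a quotient with denominator 0 is 0; this branch makes division a
    total definable operation.\<close>
  have *: "x = y / z \<longleftrightarrow> (z = 0 \<and> x = 0) \<or> (z \<noteq> 0 \<and> x * z = y)" for x y z :: real
    by (cases "z = 0") (auto simp: field_simps)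
  show ?thesis unfolding dterm_def *
    by (intro dpred_disj dpred_conj dpred_neg dpred_eq dterm_mult dterm_const
        dterm_var dterm_shift assms)
qed

lemma dpred_mem_finite: "finite F \<Longrightarrow> dterm t \<Longrightarrow> dpred (\<lambda>v. t v \<in> F)"
proof (induction F rule: finite_induct)
  case empty
  then show ?case by (simp add: dpred_const)
next
  case (insert x F)
  then show ?case unfolding insert_iff by (intro dpred_disj dpred_eq dterm_const) auto
qed

section \<open>Lists of terms, definable relations and suprema\<close>

lemma dvec_map:
  "(\<And>i. dterm (t i)) \<Longrightarrow> b - a = n \<Longrightarrow> dvec n (\<lambda>v. map (\<lambda>i. t i v) [a..<b])"
  by (auto simp: dvec_def)

lemma dvec_const: "length a = n \<Longrightarrow> dvec n (\<lambda>v. a)"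
  by (auto simp: dvec_def dterm_const)

lemma dvec_Nil: "dvec 0 (\<lambda>v. [])"
  by (auto simp: dvec_def)

lemma dvec_Cons: "dterm t \<Longrightarrow> dvec n s \<Longrightarrow> dvec (Suc n) (\<lambda>v. t v # s v)"
  by (auto simp: dvec_def less_Suc_eq_0_disj)

lemma dvec_append:
  assumes "dvec m t" "dvec n s" "k = m + n"
  shows "dvec k (\<lambda>v. t v @ s v)"
proof -
  have "dterm (\<lambda>v. (t v @ s v) ! i)" if "i < m + n" for i
  proof (cases "i < m")
    case True
    then show ?thesis using assms by (simp add: dvec_def nth_append)
  next
    case False
    then have "i - m < n" using that by simp
    then show ?thesis using assms False by (simp add: dvec_def nth_append)
  qed
  then show ?thesis using assms by (simp add: dvec_def)
qed

lemma dvec_snoc: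
  assumes "dvec n t" "dterm s"
  shows "dvec (Suc n) (\<lambda>v. t v @ [s v])"
  by (rule dvec_append[OF assms(1) dvec_Cons[OF assms(2) dvec_Nil]]) simp

lemma dvec_take: "dvec m t \<Longrightarrow> n \<le> m \<Longrightarrow> dvec n (\<lambda>v. take n (t v))"
  by (auto simp: dvec_def)

lemma dvec_drop: "dvec m t \<Longrightarrow> k \<le> m \<Longrightarrow> n = m - k \<Longrightarrow> dvec n (\<lambda>v. drop k (t v))"
  by (auto simp: dvec_def)

lemma dterm_nth: "dvec n t \<Longrightarrow> i < n \<Longrightarrow> dterm (\<lambda>v. t v ! i)"
  by (simp add: dvec_def)

definition drel :: "nat \<Rightarrow> nat \<Rightarrow> (real list \<Rightarrow> real list \<Rightarrow> bool) \<Rightarrow> bool" where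
  "drel m n R \<longleftrightarrow> dpred (\<lambda>v. R (map v [0..<m]) (map (\<lambda>i. v (m + i)) [0..<n]))"

definition drel1 :: "nat \<Rightarrow> (real list \<Rightarrow> real \<Rightarrow> bool) \<Rightarrow> bool" where
  "drel1 m R \<longleftrightarrow> dpred (\<lambda>v. R (map v [0..<m]) (v m))"

definition dfun :: "nat \<Rightarrow> (real list \<Rightarrow> real) \<Rightarrow> bool" where
  "dfun m e \<longleftrightarrow> dterm (\<lambda>v. e (map v [0..<m]))"

lemma dfun_subst:
  assumes "dfun m e" and t: "dvec m t"
  shows "dterm (\<lambda>v. e (t v))"
proof -
  define \<tau> where "\<tau> i = (if i < m then (\<lambda>v. t v ! i) else (\<lambda>v. 0))" for i
  have "dterm (\<tau> i)" for i
    using t by (auto simp: \<tau>_def dvec_def dterm_const)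
  from dterm_subst[OF assms(1)[unfolded dfun_def], of \<tau>, OF this]
  have "dterm (\<lambda>v. e (map (\<lambda>i. \<tau> i v) [0..<m]))" .
  moreover have "map (\<lambda>i. \<tau> i v) [0..<m] = t v" for v
    using t by (intro nth_equalityI) (auto simp: \<tau>_def dvec_def)
  ultimately show ?thesis by simp
qed

lemma drel_subst:
  assumes "drel m n R" and t: "dvec m t" and s: "dvec n s"
  shows "dpred (\<lambda>v. R (t v) (s v))"
proof -
  define \<tau> where "\<tau> i = (if i < m then (\<lambda>v. t v ! i) else
     if i - m < n then (\<lambda>v. s v ! (i - m)) else (\<lambda>v. 0))" for i
  have "dterm (\<tau> i)" for i
    using t s by (auto simp: \<tau>_def dvec_def dterm_const)
  from dpred_subst[OF assms(1)[unfolded drel_def], of \<tau>, OF this]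
  have "dpred (\<lambda>v. R (map (\<lambda>i. \<tau> i v) [0..<m]) (map (\<lambda>i. \<tau> (m + i) v) [0..<n]))" .
  moreover have "map (\<lambda>i. \<tau> i v) [0..<m] = t v" "map (\<lambda>i. \<tau> (m + i) v) [0..<n] = s v" for v
    using t s by (auto intro!: nth_equalityI simp: \<tau>_def dvec_def)
  ultimately show ?thesis by simp
qed

lemma drel1_subst:
  assumes "drel1 m R" and t: "dvec m t" and s: "dterm s"
  shows "dpred (\<lambda>v. R (t v) (s v))"
proof -
  define \<tau> where "\<tau> i = (if i < m then (\<lambda>v. t v ! i) else s)" for i
  have "dterm (\<tau> i)" for i
    using t s by (auto simp: \<tau>_def dvec_def)
  from dpred_subst[OF assms(1)[unfolded drel1_def], of \<tau>, OF this]
  have "dpred (\<lambda>v. R (map (\<lambda>i. \<tau> i v) [0..<m]) (\<tau> m v))" .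
  moreover have "map (\<lambda>i. \<tau> i v) [0..<m] = t v" "\<tau> m v = s v" for v
    using t by (auto intro!: nth_equalityI simp: \<tau>_def dvec_def)
  ultimately show ?thesis by simp
qed

lemma drel_Sig:
  assumes "X \<in> Sig (m + n)"
  shows "drel m n (\<lambda>a x. a @ x \<in> X)"
  unfolding drel_def
  by (intro dpred_mem[OF assms] dvec_append dvec_map dterm_var) simp_all

lemmas dpred_intros =
  dpred_neg dpred_conj dpred_disj dpred_imp dpred_ex dpred_all dpred_bex_Rn
  dpred_less dpred_le dpred_eq dterm_var dterm_add dterm_mult dterm_diff dterm_abs dterm_divide

text \<open>The default 0 on empty or unbounded sets makes the supremum a total term. Every use has
  to establish a member and an upper bound before the value means anything.\<close>

definition dsup :: "real set \<Rightarrow> real" where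
  "dsup Z = (if Z \<noteq> {} \<and> bdd_above Z then Sup Z else 0)"

lemma dterm_dsup:
  assumes P: "dpred (\<lambda>v. P (\<lambda>i. v (Suc i)) (v 0))"
  shows "dterm (\<lambda>v. dsup {z. P v z})"
proof -
  have *: "x = dsup {z. Q z} \<longleftrightarrow>
      ((\<exists>z. Q z) \<and> (\<exists>b. \<forall>z. Q z \<longrightarrow> z \<le> b) \<and> (\<forall>z. Q z \<longrightarrow> z \<le> x) \<and>
        (\<forall>w. w < x \<longrightarrow> (\<exists>z. Q z \<and> w < z))) \<or>
      (\<not> ((\<exists>z. Q z) \<and> (\<exists>b. \<forall>z. Q z \<longrightarrow> z \<le> b)) \<and> x = 0)" for x and Q :: "real \<Rightarrow> bool"
  proof (cases "(\<exists>z. Q z) \<and> (\<exists>b. \<forall>z. Q z \<longrightarrow> z \<le> b)")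
    case True
    then have ne: "{z. Q z} \<noteq> {}" and bdd: "bdd_above {z. Q z}" by (auto simp: bdd_above_def)
    have "x = Sup {z. Q z} \<longleftrightarrow> (\<forall>z. Q z \<longrightarrow> z \<le> x) \<and> (\<forall>w. w < x \<longrightarrow> (\<exists>z. Q z \<and> w < z))"
    proof
      assume "x = Sup {z. Q z}"
      then show "(\<forall>z. Q z \<longrightarrow> z \<le> x) \<and> (\<forall>w. w < x \<longrightarrow> (\<exists>z. Q z \<and> w < z))"
        using cSup_upper[OF _ bdd] less_cSup_iff[OF ne bdd] by auto
    next
      assume r: "(\<forall>z. Q z \<longrightarrow> z \<le> x) \<and> (\<forall>w. w < x \<longrightarrow> (\<exists>z. Q z \<and> w < z))"
      show "x = Sup {z. Q z}"
      proof (rule antisym)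
        show "x \<le> Sup {z. Q z}"
        proof (rule ccontr)
          assume "\<not> x \<le> Sup {z. Q z}"
          then obtain z where "Q z" "Sup {z. Q z} < z" using r by force
          then show False using cSup_upper[OF _ bdd, of z] by simp
        qed
        show "Sup {z. Q z} \<le> x" using r ne by (intro cSup_least) auto
      qed
    qed
    then show ?thesis using True ne bdd by (simp add: dsup_def)
  next
    case False
    then have "\<not> ({z. Q z} \<noteq> {} \<and> bdd_above {z. Q z})" by (auto simp: bdd_above_def)
    then show ?thesis using False by (auto simp: dsup_def)
  qed
  have P': "dpred (\<lambda>v. P (\<lambda>i. v (\<sigma> i)) (v j))" for \<sigma> j
    using dpred_reindex[OF P, of "case_nat j \<sigma>"] by simp
  show ?thesis unfolding dterm_def * by (intro dpred_intros dterm_const P')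
qed

end

section \<open>One-variable consequences of o-minimality\<close>

lemma frontier_interval_or_point:
  assumes "interval_or_point I"
  shows "finite (frontier I)"
proof -
  have "frontier {a<..<b} \<subseteq> {a, b}" for a b :: real
    by (cases "a < b") (auto simp: frontier_def closure_greaterThanLessThan)
  moreover have "frontier {a<..} \<subseteq> {a}" "frontier {..<a} \<subseteq> {a}" "frontier {a} \<subseteq> {a}" for a :: real
    by (auto simp: frontier_def interior_open)
  ultimately have "finite (frontier {a<..<b})" "finite (frontier {a<..})" "finite (frontier {..<a})"
    "finite (frontier {a})" for a b :: real
    by (meson finite.emptyI finite.insertI finite_subset)+
  then show ?thesis using assms unfolding interval_or_point_def by auto
qed

locale o_minimal = real_structure +
  assumes o_minimal: "o_minimal_expansion Sig"
begin

lemma definable_decomposition: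
  assumes "dpred (\<lambda>v. P (v 0))"
  obtains U where "finite U" "\<And>I. I \<in> U \<Longrightarrow> interval_or_point I" "{r. P r} = \<Union>U"
proof -
  have "{x \<in> Rn 1. P (x ! 0)} \<in> Sig 1" using assms by (intro Sig_Collect) simp
  from bspec[OF o_minimal[unfolded o_minimal_expansion_def, THEN conjunct2, THEN conjunct2] this]
  obtain U where U: "finite U" "\<forall>I\<in>U. interval_or_point I"
    "{x \<in> Rn 1. P (x ! 0)} = (\<lambda>r. [r]) ` \<Union>U"
    by (elim exE conjE) (rule that)
  have "P r \<longleftrightarrow> [r] \<in> {x \<in> Rn 1. P (x ! 0)}" for r by (simp add: Rn_def)
  then have "{r. P r} = \<Union>U" unfolding U(3) by auto
  from that[OF U(1) bspec[OF U(2)] this] show thesis .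
qed

lemma definable_frontier_finite:
  assumes "dpred (\<lambda>v. P (v 0))"
  shows "finite (frontier {r. P r})"
proof -
  obtain U where U: "finite U" "\<And>I. I \<in> U \<Longrightarrow> interval_or_point I" "{r. P r} = \<Union>U"
    using definable_decomposition[OF assms] by blast
  have "frontier (\<Union>U) \<subseteq> \<Union> (frontier ` U)"
    using frontier_Union_subset[OF U(1)] by auto
  then show ?thesis unfolding U(3)
    by (rule finite_subset) (use U frontier_interval_or_point in auto)
qed

text \<open>Every piece of the decomposition is countable, while a nondegenerate interval is not; so
  each piece is a point or empty.\<close>

lemma definable_countable_finite:
  assumes "dpred (\<lambda>v. P (v 0))" "countable {r. P r}"
  shows "finite {r. P r}"
proof -
  obtain U where U: "finite U" "\<And>I. I \<in> U \<Longrightarrow> interval_or_point I" "{r. P r} = \<Union>U"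
    using definable_decomposition[OF assms(1)] by blast
  have "finite I" if "I \<in> U" for I
  proof -
    have "countable I" using countable_subset[OF Union_upper[OF that]] assms(2) unfolding U(3) by simp
    have bounded_case: "b \<le> a" if "countable {a<..<b}" for a b :: real
      using that uncountable_open_interval[of a b] by linarith
    note I = U(2)[OF that, unfolded interval_or_point_def]
    consider a where "I = {a}" | a b where "I = {a<..<b}" | a where "{a<..<a + 1} \<subseteq> I"
      using I
    proof (elim disjE exE)
      fix b assume "I = {..<b}"
      then show thesis by (intro that(3)[of "b - 1"]) auto
    next
      fix b assume "I = {b<..}"
      then show thesis by (intro that(3)[of b]) auto
    next
      assume "I = UNIV"
      then show thesis by (intro that(3)[of 0]) auto
    qed (use that(1,2) in auto)
    then show ?thesis
    proof cases
      case (3 a)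
      then show ?thesis using bounded_case[of a "a + 1"] countable_subset[OF _ \<open>countable I\<close>] by simp
    next
      case (2 a b)
      then have "b \<le> a" by (intro bounded_case) (use \<open>countable I\<close> in metis)
      then show ?thesis unfolding 2 by simp
    next
      case (1 a)
      then show ?thesis by simp
    qed
  qed
  then show ?thesis using U by auto
qed

text \<open>The ray beyond the largest frontier point is connected and misses the frontier, so it
  lies on one side of the set.\<close>

lemma definable_eventually_at_top:
  assumes "dpred (\<lambda>v. P (v 0))"
  shows "eventually P at_top \<or> eventually (\<lambda>x. \<not> P x) at_top"
proof -
  define M where "M = Max (insert 0 (frontier {r. P r}))"
  have M: "x \<le> M" if "x \<in> frontier {r. P r}" for x
    using definable_frontier_finite[OF assms] that by (simp add: M_def)
  have "{M<..} \<subseteq> {r. P r} \<or> {M<..} \<inter> {r. P r} = {}"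
    using connected_Int_frontier[of "{M<..}" "{r. P r}"] M by force
  then have "(\<forall>x>M. P x) \<or> (\<forall>x>M. \<not> P x)" by auto
  then show ?thesis unfolding eventually_at_top_dense by metis
qed

end

section \<open>Uniform finiteness\<close>

text \<open>The factor 2 makes matching within distance \<open>e\<close> injective: two points of
  \<open>T\<close> closer than \<open>e\<close> to the same point coincide.\<close>

definition gap_ge :: "real \<Rightarrow> (real \<Rightarrow> bool) \<Rightarrow> bool" where
  "gap_ge e T \<longleftrightarrow> (\<forall>y. \<forall>z. T y \<and> T z \<and> y \<noteq> z \<longrightarrow> 2 * e \<le> \<bar>y - z\<bar>)"

text \<open>Closeness in the Hausdorff sense, spelled out with quantifiers over reals so that it is
  a definable condition.\<close>

definition near :: "real \<Rightarrow> (real \<Rightarrow> bool) \<Rightarrow> (real \<Rightarrow> bool) \<Rightarrow> bool" where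
  "near e T T' \<longleftrightarrow> (\<forall>y. T y \<longrightarrow> (\<exists>z. T' z \<and> \<bar>y - z\<bar> < e)) \<and> (\<forall>z. T' z \<longrightarrow> (\<exists>y. T y \<and> \<bar>y - z\<bar> < e))"

lemma near_sym: "near e T T' \<Longrightarrow> near e T' T"
  unfolding near_def by (simp add: abs_minus_commute)

lemma near_trans:
  assumes "near e T T'" "near d T' T''"
  shows "near (e + d) T T''"
proof -
  have *: "\<exists>z. T'' z \<and> \<bar>y - z\<bar> < e + d" if n: "near e T T'" "near d T' T''" "T y" for T T' T'' y e d
  proof -
    obtain x z where "T' x" "\<bar>y - x\<bar> < e" "T'' z" "\<bar>x - z\<bar> < d"
      using n unfolding near_def by meson
    then show ?thesis by (intro exI[of _ z]) auto
  qed
  show ?thesis unfolding near_def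
    using *[OF assms] *[OF near_sym[OF assms(2)] near_sym[OF assms(1)]]
    by (auto simp: abs_minus_commute add.commute)
qed

lemma card_le_of_near:
  assumes "gap_ge e T" "near e T T'" "finite {y. T' y}"
  shows "card {y. T y} \<le> card {y. T' y}"
proof -
  obtain f where f: "\<And>y. T y \<Longrightarrow> T' (f y) \<and> \<bar>y - f y\<bar> < e"
    using assms(2) unfolding near_def by metis
  have "inj_on f {y. T y}"
  proof (rule inj_onI, rule ccontr)
    fix y z assume yz: "y \<in> {y. T y}" "z \<in> {y. T y}" "f y = f z" "y \<noteq> z"
    then have "2 * e \<le> \<bar>y - z\<bar>" using assms(1) unfolding gap_ge_def by blast
    then show False using f[of y] f[of z] yz by auto
  qed
  then show ?thesis by (rule card_inj_on_le) (use f assms(3) in auto)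
qed

text \<open>A definable condition forcing the number of points of the fibres to be constant near \<^term>\<open>s\<close>.\<close>

definition stable_at :: "(real \<Rightarrow> real \<Rightarrow> bool) \<Rightarrow> real \<Rightarrow> bool" where
  "stable_at E s \<longleftrightarrow> (\<exists>e. \<exists>d. 0 < e \<and> 0 < d \<and>
     (\<forall>s'. \<bar>s' - s\<bar> < d \<longrightarrow> gap_ge e (E s') \<and> near e (E s) (E s')))"

text \<open>Near a stable point both fibres have the gap property, so matching nearby points gives
  injections in both directions. Hence the cardinality is locally constant, and constant on
  connected sets.\<close>

lemma stable_card_constant:
  assumes "\<And>s. finite {y. E s y}" "connected A" "\<And>s. s \<in> A \<Longrightarrow> stable_at E s" "a \<in> A" "b \<in> A"
  shows "card {y. E a y} = card {y. E b y}"
proof (rule connected_local_const[OF assms(2,4,5), where f = "\<lambda>s. card {y. E s y}"], rule ballI)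
  fix s assume "s \<in> A"
  then obtain e d where ed: "0 < e" "0 < d"
      "\<And>s'. \<bar>s' - s\<bar> < d \<Longrightarrow> gap_ge e (E s') \<and> near e (E s) (E s')"
    using assms(3) unfolding stable_at_def by meson
  have "card {y. E s y} = card {y. E s' y}" if "\<bar>s' - s\<bar> < d" for s'
    using ed(3)[of s] ed(3)[OF that] ed(2) assms(1)
    by (intro antisym card_le_of_near) (auto intro: near_sym)
  then show "\<forall>\<^sub>F s' in at s within A. card {y. E s y} = card {y. E s' y}"
    unfolding eventually_at using ed(2) by (auto simp: dist_real_def intro!: exI[of _ d])
qed

lemma finite_gap_ge:
  assumes "finite {y. T y}"
  shows "\<exists>n. gap_ge (1 / Suc n) T"
proof -
  define D where "D = insert 1 ((\<lambda>(y, z). \<bar>y - z\<bar>) ` {(y, z). T y \<and> T z \<and> y \<noteq> z})"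
  have "{(y, z). T y \<and> T z \<and> y \<noteq> z} \<subseteq> {y. T y} \<times> {y. T y}" by auto
  then have fin: "finite D" unfolding D_def using assms finite_subset by blast
  then have "0 < Min D" by (auto simp: D_def)
  then obtain n where n: "inverse (real (Suc n)) < Min D / 2"
    using reals_Archimedean[of "Min D / 2"] by auto
  have "2 * (1 / Suc n) \<le> \<bar>y - z\<bar>" if "T y" "T z" "y \<noteq> z" for y z
  proof -
    have "Min D \<le> \<bar>y - z\<bar>" using fin that by (intro Min_le) (auto simp: D_def)
    then show ?thesis using n by (simp add: inverse_eq_divide)
  qed
  then show ?thesis unfolding gap_ge_def by blast
qed

lemma finite_near_rat:
  assumes "finite {y. T y}" "0 < e"
  shows "\<exists>Q :: rat list. near e T (\<lambda>z. z \<in> of_rat ` set Q)"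
proof -
  have "\<exists>q. \<bar>y - of_rat q\<bar> < e" for y
  proof -
    obtain q where "y - e < of_rat q" "of_rat q < y + e"
      using of_rat_dense[of "y - e" "y + e"] assms(2) by auto
    then show ?thesis by (intro exI[of _ q]) auto
  qed
  then obtain r where r: "\<And>y. \<bar>y - of_rat (r y)\<bar> < e" by metis
  obtain Q where "set Q = r ` {y. T y}" using finite_list[OF finite_imageI[OF assms(1), of r]] by blast
  then show ?thesis unfolding near_def using r by (intro exI[of _ Q]) auto
qed

text \<open>Every fibre lies in one of countably many classes, indexed by a gap and a rational
  approximation; a point outside the frontiers of all classes is stable.\<close>

lemma countable_unstable:
  assumes fin: "\<And>s. finite {y. E s y}"
    and fr: "\<And>n Q. countable (frontier {s. gap_ge (1 / Suc n) (E s) \<and>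
        near (1 / Suc n / 2) (E s) (\<lambda>z. z \<in> of_rat ` set (Q :: rat list))})"
  shows "countable {s. \<not> stable_at E s}"
proof -
  define C where "C n Q = {s. gap_ge (1 / Suc n) (E s) \<and>
        near (1 / Suc n / 2) (E s) (\<lambda>z. z \<in> of_rat ` set (Q :: rat list))}" for n Q
  have "s \<in> (\<Union>n. \<Union>Q. frontier (C n Q))" if "\<not> stable_at E s" for s
  proof (rule ccontr)
    assume no: "s \<notin> (\<Union>n. \<Union>Q. frontier (C n Q))"
    obtain n where n: "gap_ge (1 / Suc n) (E s)" using finite_gap_ge[OF fin] by blast
    \<comment> \<open>Half of the gap radius: two fibres approximated by the same \<open>Q\<close>
      are then within the full radius \<open>1 / Suc n\<close> of each other.\<close>
    obtain Q :: "rat list" where Q: "near (1 / Suc n / 2) (E s) (\<lambda>z. z \<in> of_rat ` set Q)"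
      using finite_near_rat[OF fin, of "1 / Suc n / 2"] by auto
    have "s \<in> C n Q" using n Q by (simp add: C_def)
    then have "s \<in> interior (C n Q)"
      using no closure_subset[of "C n Q"] by (auto simp: frontier_def)
    then obtain d where d: "0 < d" "ball s d \<subseteq> C n Q" by (auto simp: mem_interior)
    have "gap_ge (1 / Suc n) (E s') \<and> near (1 / Suc n) (E s) (E s')" if "\<bar>s' - s\<bar> < d" for s'
    proof -
      have "s' \<in> C n Q" using d(2) that by (auto simp: dist_real_def abs_minus_commute subset_iff)
      then have s': "gap_ge (1 / Suc n) (E s')" "near (1 / Suc n / 2) (E s') (\<lambda>z. z \<in> of_rat ` set Q)"
        by (simp_all add: C_def)
      show ?thesis using s'(1) near_trans[OF Q near_sym[OF s'(2)]] by (simp only: field_sum_of_halves)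
    qed
    then have "stable_at E s" unfolding stable_at_def
      using d(1) by (intro exI[of _ "1 / Suc n"] exI[of _ d]) auto
    then show False using that by simp
  qed
  then have "{s. \<not> stable_at E s} \<subseteq> (\<Union>n. \<Union>Q. frontier (C n Q))" by blast
  moreover have "countable (\<Union>n. \<Union>Q. frontier (C n Q))"
    using fr unfolding C_def by (intro countable_UN) auto
  ultimately show ?thesis by (rule countable_subset)
qed

text \<open>Each component of the complement of \<open>Z\<close> contains a listed point: 0 if
  \<open>Z\<close> is empty, a shifted end point if the component is a half-line, a midpoint if it
  is bounded. All of them are arithmetic expressions in at most two points of \<open>Z\<close>, so
  they become definable functions once the points of \<open>Z\<close> are.\<close>

lemma sample_point:
  fixes N :: "real \<Rightarrow> nat"
  assumes Z: "finite Z"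
    and const: "\<And>A a b. connected A \<Longrightarrow> A \<inter> Z = {} \<Longrightarrow> a \<in> A \<Longrightarrow> b \<in> A \<Longrightarrow> N a = N b"
  shows "N s = N 0 \<or> (\<exists>l\<in>Z. \<exists>u\<in>Z. N s = N l \<or> N s = N (l + 1) \<or> N s = N (l - 1) \<or> N s = N ((l + u) / 2))"
proof (cases "s \<in> Z")
  case True
  then show ?thesis by auto
next
  case False
  define L where "L = {z \<in> Z. z < s}"
  define U where "U = {z \<in> Z. s < z}"
  have fin: "finite L" "finite U" using Z by (auto simp: L_def U_def)
  have L: "Max L \<in> Z" "Max L < s" "\<And>z. z \<in> Z \<Longrightarrow> z < s \<Longrightarrow> z \<le> Max L" if "L \<noteq> {}"
    using Max_in[OF fin(1) that] Max_ge[OF fin(1)] by (auto simp: L_def)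
  have U: "Min U \<in> Z" "s < Min U" "\<And>z. z \<in> Z \<Longrightarrow> s < z \<Longrightarrow> Min U \<le> z" if "U \<noteq> {}"
    using Min_in[OF fin(2) that] Min_le[OF fin(2)] by (auto simp: U_def)
  consider "L = {}" "U = {}" | "L = {}" "U \<noteq> {}" | "L \<noteq> {}" "U = {}" | "L \<noteq> {}" "U \<noteq> {}" by blast
  then show ?thesis
  proof cases
    case 1
    then have "UNIV \<inter> Z = {}" using False unfolding L_def U_def by (auto, metis less_linear)
    then have "N s = N 0" by (intro const[of UNIV]) auto
    then show ?thesis by simp
  next
    case 2
    then have "z \<notin> Z" if "z < Min U" for z
      using False that U(3)[OF 2(2), of z] unfolding L_def by (metis (mono_tags, lifting) empty_Collect_eq linorder_neqE_linordered_idom not_less)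
    then have "N s = N (Min U - 1)"
      using U(2)[OF 2(2)] by (intro const[of "{..<Min U}"]) auto
    then show ?thesis using U(1)[OF 2(2)] by blast
  next
    case 3
    then have "z \<notin> Z" if "Max L < z" for z
      using False that L(3)[OF 3(1), of z] unfolding U_def by (metis (mono_tags, lifting) empty_Collect_eq linorder_neqE_linordered_idom not_less)
    then have "N s = N (Max L + 1)"
      using L(2)[OF 3(1)] by (intro const[of "{Max L<..}"]) auto
    then show ?thesis using L(1)[OF 3(1)] by blast
  next
    case 4
    then have "z \<notin> Z" if "Max L < z" "z < Min U" for z
      using False that L(3)[OF 4(1), of z] U(3)[OF 4(2), of z] by (metis linorder_neqE_linordered_idom not_less)
    then have "N s = N ((Max L + Min U) / 2)"
      using L(2)[OF 4(1)] U(2)[OF 4(2)] by (intro const[of "{Max L<..<Min U}"]) auto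
    then show ?thesis using L(1)[OF 4(1)] U(1)[OF 4(2)] by blast
  qed
qed

section \<open>From finite fibres to uniformly bounded fibres\<close>

context real_structure
begin

lemma dpred_stable_at:
  assumes E: "\<And>\<sigma> i j. dpred (\<lambda>v. E (\<lambda>k. v (\<sigma> k)) (v i) (v j))" and s: "dterm s"
  shows "dpred (\<lambda>v. stable_at (E v) (s v))"
proof -
  have "dpred (\<lambda>v. stable_at (E (\<lambda>i. v (Suc i))) (v 0))"
    unfolding stable_at_def gap_ge_def near_def by (intro dpred_intros dterm_const E)
  from dpred_term[OF this s] show ?thesis .
qed

text \<open>The least point of a fibre is a definable function of the parameter, with default 0 on
  empty fibres; deleting it lowers the bound \<open>K\<close> by one.\<close>

lemma finite_cover_functions:
  assumes "drel1 m R" "\<And>a. a \<in> Rn m \<Longrightarrow> finite {y. R a y}" "\<And>a. a \<in> Rn m \<Longrightarrow> card {y. R a y} \<le> K"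
  shows "\<exists>F. finite F \<and> (\<forall>e\<in>F. dfun m e) \<and> (\<forall>a\<in>Rn m. \<forall>y. R a y \<longrightarrow> (\<exists>e\<in>F. y = e a))"
  using assms
proof (induction K arbitrary: R)
  case 0
  then have "{y. R a y} = {}" if "a \<in> Rn m" for a using that by simp
  then show ?case by (intro exI[of _ "{}"]) simp
next
  case (Suc K)
  define e where "e a = (if \<exists>y. R a y then Min {y. R a y} else 0)" for a
  have e_eq: "y = e a \<longleftrightarrow> (R a y \<and> (\<forall>z. R a z \<longrightarrow> y \<le> z)) \<or> (\<not> (\<exists>z. R a z) \<and> y = 0)"
    if "a \<in> Rn m" for a y
  proof (cases "\<exists>z. R a z")
    case True
    then have "{z. R a z} \<noteq> {}" by blast
    from Min_eq_iff[OF Suc.prems(2)[OF that] this, of y] show ?thesis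
      using True by (auto simp: e_def)
  qed (simp add: e_def)
  have dfun_e: "dfun m e"
  proof -
    have "dpred (\<lambda>v. (R (map (\<lambda>i. v (Suc i)) [0..<m]) (v 0) \<and>
          (\<forall>z. R (map (\<lambda>i. v (Suc i)) [0..<m]) z \<longrightarrow> v 0 \<le> z)) \<or>
        (\<not> (\<exists>z. R (map (\<lambda>i. v (Suc i)) [0..<m]) z) \<and> v 0 = 0))"
      by (intro dpred_intros drel1_subst[OF Suc.prems(1)] dvec_map dterm_const) simp_all
    then show ?thesis unfolding dfun_def dterm_def by (simp add: e_eq Rn_def)
  qed
  define R' where "R' a y \<longleftrightarrow> R a y \<and> y \<noteq> e a" for a y
  have "drel1 m R'"
    unfolding drel1_def R'_def
    by (intro dpred_intros drel1_subst[OF Suc.prems(1)] dfun_subst[OF dfun_e] dvec_map) simp_all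
  moreover have "finite {y. R' a y}" if "a \<in> Rn m" for a
    using Suc.prems(2)[OF that] by (rule rev_finite_subset) (auto simp: R'_def)
  moreover have "card {y. R' a y} \<le> K" if a: "a \<in> Rn m" for a
  proof (cases "\<exists>y. R a y")
    case True
    then have "R a (e a)" using e_eq[OF a, of "e a"] by auto
    then have "{y. R' a y} \<subset> {y. R a y}" by (auto simp: R'_def)
    then have "card {y. R' a y} < card {y. R a y}"
      using Suc.prems(2)[OF a] by (rule psubset_card_mono[rotated])
    then show ?thesis using Suc.prems(3)[OF a] by simp
  next
    case False
    then show ?thesis by (simp add: R'_def)
  qed
  ultimately obtain F where F: "finite F" "\<forall>e\<in>F. dfun m e"
      "\<forall>a\<in>Rn m. \<forall>y. R' a y \<longrightarrow> (\<exists>e\<in>F. y = e a)"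
    using Suc.IH[of R'] by metis
  show ?case
    by (rule exI[of _ "insert e F"]) (use F dfun_e in \<open>auto simp: R'_def\<close>)
qed

end

context o_minimal
begin

text \<open>The induction hypothesis is used twice: on the unstable values of the last parameter,
  which thereby become the values of finitely many definable functions, and then on the fibres over
  each of the sample functions in \<open>G\<close>.\<close>

theorem uniform_finiteness:
  assumes "drel1 m R" "\<And>a. a \<in> Rn m \<Longrightarrow> finite {y. R a y}"
  shows "\<exists>K. \<forall>a\<in>Rn m. card {y. R a y} \<le> K"
  using assms
proof (induction m arbitrary: R)
  case 0
  then show ?case by (auto simp: Rn_def)
next
  case (Suc m)
  define E where "E a s y \<longleftrightarrow> R (a @ [s]) y" for a s y
  have fin: "finite {y. E a s y}" if "a \<in> Rn m" for a s
    unfolding E_def using that by (intro Suc.prems(2)) (simp add: Rn_def)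
  have dE: "dpred (\<lambda>v. E (t v) (s v) (y v))" if "dvec m t" "dterm s" "dterm y" for t s y
    unfolding E_def
    by (intro drel1_subst[OF Suc.prems(1)] dvec_snoc that)
  define Bad where "Bad a s \<longleftrightarrow> \<not> stable_at (E a) s" for a s
  have dBad: "drel1 m Bad"
    unfolding drel1_def Bad_def
    by (intro dpred_neg dpred_stable_at dE dvec_map dterm_var) simp
  have fBad: "finite {s. Bad a s}" if a: "a \<in> Rn m" for a
  proof (rule definable_countable_finite)
    have da: "dvec m (\<lambda>v. a)" using a by (intro dvec_const) (simp add: Rn_def)
    show "dpred (\<lambda>v. Bad a (v 0))" by (intro drel1_subst[OF dBad] da dterm_var)
    show "countable {s. Bad a s}" unfolding Bad_def
    proof (rule countable_unstable[OF fin[OF a]])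
      \<comment> \<open>For fixed \<open>n\<close> and \<open>Q\<close> the class is definable, so
        its frontier is finite; only the union over all \<open>n\<close> and \<open>Q\<close> is
        merely countable.\<close>
      fix n and Q :: "rat list"
      have "dpred (\<lambda>v. gap_ge (1 / Suc n) (E a (v 0)) \<and>
          near (1 / Suc n / 2) (E a (v 0)) (\<lambda>z. z \<in> of_rat ` set Q))"
        unfolding gap_ge_def near_def
        by (intro dpred_intros dE da dterm_const dpred_mem_finite) simp_all
      then show "countable (frontier {s. gap_ge (1 / Suc n) (E a s) \<and>
          near (1 / Suc n / 2) (E a s) (\<lambda>z. z \<in> of_rat ` set Q)})"
        by (intro countable_finite definable_frontier_finite)
    qed
  qed
  obtain K where "\<forall>a\<in>Rn m. card {s. Bad a s} \<le> K" using Suc.IH[OF dBad fBad] by blast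
  then obtain F where F: "finite F" "\<forall>e\<in>F. dfun m e"
      "\<forall>a\<in>Rn m. \<forall>s. Bad a s \<longrightarrow> (\<exists>e\<in>F. s = e a)"
    using finite_cover_functions[OF dBad fBad] by metis
  txt \<open>The values of \<open>G\<close> contain all unstable points and meet every component of their complement.\<close>
  define G where "G = insert (\<lambda>a. 0) (F \<union> (\<lambda>e a. e a + 1) ` F \<union> (\<lambda>e a. e a - 1) ` F \<union>
      (\<lambda>(e, e') a. (e a + e' a) / 2) ` (F \<times> F))"
  have "finite G" using F(1) by (simp add: G_def)
  have dG: "dfun m g" if "g \<in> G" for g
  proof -
    have "dfun m (\<lambda>a. 0)" unfolding dfun_def by (rule dterm_const)
    moreover have "dfun m (\<lambda>a. e a + 1)" "dfun m (\<lambda>a. e a - 1)"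
        "dfun m (\<lambda>a. (e a + e' a) / 2)" if "dfun m e" "dfun m e'" for e e'
      using that unfolding dfun_def
      by (intro dterm_add dterm_diff dterm_divide dterm_const; simp)+
    ultimately show ?thesis using that F(2) unfolding G_def by auto
  qed
  have "\<exists>K. \<forall>a\<in>Rn m. card {y. E a (g a) y} \<le> K" if "g \<in> G" for g
  proof (rule Suc.IH)
    show "drel1 m (\<lambda>a. E a (g a))"
      unfolding drel1_def
      by (intro dE dvec_map dfun_subst[OF dG[OF that]] dterm_var) simp_all
  qed (rule fin)
  then obtain K' where K': "\<And>g a. g \<in> G \<Longrightarrow> a \<in> Rn m \<Longrightarrow> card {y. E a (g a) y} \<le> K' g"
    by metis
  define M where "M = Max (K' ` G)"
  have M: "card {y. E a (g a) y} \<le> M" if "g \<in> G" "a \<in> Rn m" for g a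
    using K'[OF that] \<open>finite G\<close> that(1) unfolding M_def by (meson Max_ge finite_imageI image_eqI order_trans)
  have "card {y. E a s y} \<le> M" if a: "a \<in> Rn m" for a s
  proof -
    have const: "card {y. E a s y} = card {y. E a s' y}"
      if "connected A" "A \<inter> {s. Bad a s} = {}" "s \<in> A" "s' \<in> A" for A s s'
      using that fin[OF a] by (intro stable_card_constant[of "E a" A]) (auto simp: Bad_def)
    have "card {y. E a s y} = card {y. E a 0 y} \<or> (\<exists>l\<in>{s. Bad a s}. \<exists>u\<in>{s. Bad a s}.
        card {y. E a s y} = card {y. E a l y} \<or> card {y. E a s y} = card {y. E a (l + 1) y} \<or>
        card {y. E a s y} = card {y. E a (l - 1) y} \<or> card {y. E a s y} = card {y. E a ((l + u) / 2) y})"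
      by (rule sample_point[OF fBad[OF a]]) (rule const)
    then have "\<exists>g\<in>G. card {y. E a s y} = card {y. E a (g a) y}"
    proof (elim disjE bexE)
      assume "card {y. E a s y} = card {y. E a 0 y}"
      then show ?thesis by (auto simp: G_def)
    next
      fix l u assume "l \<in> {s. Bad a s}" "u \<in> {s. Bad a s}"
      then obtain e e' where e: "e \<in> F" "l = e a" "e' \<in> F" "u = e' a" using F(3) a by blast
      then have "e \<in> G" "(\<lambda>a. e a + 1) \<in> G" "(\<lambda>a. e a - 1) \<in> G" "(\<lambda>a. (e a + e' a) / 2) \<in> G"
        by (auto simp: G_def)
      note * = bexI[OF _ this(1)] bexI[OF _ this(2)] bexI[OF _ this(3)] bexI[OF _ this(4)]
      show "card {y. E a s y} = card {y. E a l y} \<Longrightarrow> ?thesis"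
        "card {y. E a s y} = card {y. E a (l + 1) y} \<Longrightarrow> ?thesis"
        "card {y. E a s y} = card {y. E a (l - 1) y} \<Longrightarrow> ?thesis"
        "card {y. E a s y} = card {y. E a ((l + u) / 2) y} \<Longrightarrow> ?thesis"
        using e by (auto intro: *)
    qed
    then show ?thesis using M a by auto
  qed
  moreover have "\<exists>a s. a \<in> Rn m \<and> b = a @ [s]" if "b \<in> Rn (Suc m)" for b
    using that by (auto simp: Rn_def length_Suc_conv_rev)
  ultimately show ?case unfolding E_def by (intro exI[of _ M]) blast
qed

end

section \<open>Cells\<close>

lemma Rn_Suc_snoc:
  "(\<forall>x\<in>Rn (Suc n). P x) \<longleftrightarrow> (\<forall>x\<in>Rn n. \<forall>y. P (x @ [y]))"
  by (auto simp: Rn_def length_Suc_conv_rev)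

lemma finite_interval_around:
  fixes y :: real
  assumes Q: "finite Q" "y \<notin> Q"
  shows "\<exists>J. connected J \<and> y \<in> J \<and> J \<inter> Q = {} \<and>
    (J = UNIV \<or> (\<exists>l\<in>Q. J = {l<..}) \<or> (\<exists>u\<in>Q. J = {..<u}) \<or> (\<exists>l\<in>Q. \<exists>u\<in>Q. J = {l<..<u}))"
proof -
  \<comment> \<open>The component of \<open>y\<close> in the complement of \<open>Q\<close>, written
    as an intersection of half-lines so that its shape follows by induction on
    \<open>Q\<close>.\<close>
  define J where "J = \<Inter> ((\<lambda>q. if q < y then {q<..} else {..<q}) ` Q)"
  have "connected J \<and> y \<in> J \<and> J \<inter> Q = {} \<and>
    (J = UNIV \<or> (\<exists>l\<in>Q. J = {l<..}) \<or> (\<exists>u\<in>Q. J = {..<u}) \<or> (\<exists>l\<in>Q. \<exists>u\<in>Q. J = {l<..<u}))"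
    unfolding J_def using Q
  proof (induction Q rule: finite_induct)
    case empty
    then show ?case by simp
  next
    case (insert q Q)
    define J where "J = \<Inter> ((\<lambda>q. if q < y then {q<..} else {..<q}) ` Q)"
    have IH: "connected J" "y \<in> J" "J \<inter> Q = {}"
      "J = UNIV \<or> (\<exists>l\<in>Q. J = {l<..}) \<or> (\<exists>u\<in>Q. J = {..<u}) \<or> (\<exists>l\<in>Q. \<exists>u\<in>Q. J = {l<..<u})"
      using insert.IH insert.prems unfolding J_def by auto
    have int: "{a<..} \<inter> {b<..} = {max a b<..}" "{..<a} \<inter> {..<b} = {..<min a b}"
      "{a<..} \<inter> {..<b} = {a<..<b}" "{..<b} \<inter> {a<..} = {a<..<b}"
      "{a<..} \<inter> {b<..<c} = {max a b<..<c}" "{..<a} \<inter> {b<..<c} = {b<..<min a c}" for a b c :: real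
      by auto
    have shape: "(if q < y then {q<..} else {..<q}) \<inter> J = UNIV \<or>
        (\<exists>l\<in>insert q Q. (if q < y then {q<..} else {..<q}) \<inter> J = {l<..}) \<or>
        (\<exists>u\<in>insert q Q. (if q < y then {q<..} else {..<q}) \<inter> J = {..<u}) \<or>
        (\<exists>l\<in>insert q Q. \<exists>u\<in>insert q Q. (if q < y then {q<..} else {..<q}) \<inter> J = {l<..<u})"
      using IH(4) by (elim disjE bexE) (auto simp: int max_def min_def)
    then have "connected ((if q < y then {q<..} else {..<q}) \<inter> J)" by fastforce
    moreover have "y \<in> (if q < y then {q<..} else {..<q}) \<inter> J"
      "(if q < y then {q<..} else {..<q}) \<inter> J \<inter> insert q Q = {}"
      using IH insert.prems by auto
    ultimately show ?case using shape unfolding image_insert Inter_insert J_def[symmetric] by blast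
  qed
  then show ?thesis by blast
qed

context o_minimal
begin

text \<open>By uniform finiteness, finitely many definable functions of \<open>b @ x\<close> cover
  the frontiers of the fibres. The index of the function is stored as a real entry in front of
  \<open>b\<close>, so one relation \<open>pt\<close> with \<open>Suc m\<close> parameters serves
  for every \<open>B\<close>, whatever its size.\<close>

lemma frontier_points:
  assumes X: "drel m (Suc n) X"
  obtains w pt where
    "\<And>t s r. dvec w t \<Longrightarrow> dvec n s \<Longrightarrow> dterm r \<Longrightarrow> dpred (\<lambda>v. pt (t v) (s v) (r v))"
    "\<And>d x y z. pt d x y \<Longrightarrow> pt d x z \<Longrightarrow> y = z"
    "\<And>B. finite B \<Longrightarrow> B \<subseteq> Rn m \<Longrightarrow> \<exists>D. finite D \<and> D \<subseteq> Rn w \<and>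
       (\<forall>x\<in>Rn n. \<forall>b\<in>B. \<forall>y\<in>frontier {y. X b (x @ [y])}. \<exists>d\<in>D. pt d x y)"
proof -
  define R where "R c y \<longleftrightarrow> y \<in> frontier {z. X (take m c) (drop m c @ [z])}" for c y
  have fr: "y \<in> frontier {z. A z} \<longleftrightarrow>
      (\<forall>e. 0 < e \<longrightarrow> (\<exists>z. A z \<and> \<bar>y - z\<bar> < e) \<and> (\<exists>z. \<not> A z \<and> \<bar>y - z\<bar> < e))"
    for y and A :: "real \<Rightarrow> bool"
    by (auto simp: frontier_straddle dist_real_def)
  have dX: "dpred (\<lambda>v. X (take m (t v)) (drop m (t v) @ [r v]))" if "dvec (m + n) t" "dterm r" for t r
    by (intro drel_subst[OF X] dvec_take[OF that(1)] dvec_snoc dvec_drop[OF that(1)] that(2)) simp_all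
  have dR: "drel1 (m + n) R"
    unfolding drel1_def R_def fr
    by (intro dpred_intros dX dvec_map dterm_const) simp_all
  have fR: "finite {y. R c y}" if "c \<in> Rn (m + n)" for c
  proof -
    have "dvec (m + n) (\<lambda>v. c)" using that by (intro dvec_const) (simp add: Rn_def)
    then show ?thesis unfolding R_def Collect_mem_eq
      by (intro definable_frontier_finite dX dterm_var)
  qed
  obtain K where "\<forall>c\<in>Rn (m + n). card {y. R c y} \<le> K" using uniform_finiteness[OF dR fR] by blast
  then obtain F where F: "finite F" "\<forall>e\<in>F. dfun (m + n) e"
      "\<forall>c\<in>Rn (m + n). \<forall>y. R c y \<longrightarrow> (\<exists>e\<in>F. y = e c)"
    using finite_cover_functions[OF dR fR] by metis
  obtain es where es: "set es = F" using finite_list[OF F(1)] by blast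
  define pt where "pt d x y \<longleftrightarrow> (\<exists>k<length es. d ! 0 = real k \<and> y = (es ! k) (drop 1 d @ x))" for d x y
  show thesis
  proof (rule that[of "Suc m" pt])
    show "dpred (\<lambda>v. pt (t v) (s v) (r v))" if "dvec (Suc m) t" "dvec n s" "dterm r" for t s r
      unfolding pt_def
    proof (intro dpred_bex_less dpred_conj dpred_eq dterm_nth[OF that(1)] dterm_const that(3))
      fix k assume "k < length es"
      then have "dfun (m + n) (es ! k)" using F(2) es by auto
      from dfun_subst[OF this dvec_append[OF dvec_drop[OF that(1), of 1 m] that(2)]]
      show "dterm (\<lambda>v. (es ! k) (drop 1 (t v) @ s v))" by simp
    qed simp
    show "y = z" if "pt d x y" "pt d x z" for d x y z using that unfolding pt_def by auto
    fix B assume B: "finite B" "B \<subseteq> Rn m"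
    define D where "D = (\<lambda>(k, b). real k # b) ` ({..<length es} \<times> B)"
    have "\<exists>d\<in>D. pt d x y" if "x \<in> Rn n" "b \<in> B" "y \<in> frontier {y. X b (x @ [y])}" for x b y
    proof -
      have "length b = m" using that(2) B by (auto simp: Rn_def)
      then have "R (b @ x) y" "b @ x \<in> Rn (m + n)" using that by (auto simp: R_def Rn_def)
      then obtain k where "k < length es" "y = (es ! k) (b @ x)" using F(3) es by (metis in_set_conv_nth)
      then show ?thesis using that(2)
        by (intro bexI[of _ "real k # b"]) (auto simp: pt_def D_def)
    qed
    moreover have "finite D" "D \<subseteq> Rn (Suc m)" using B by (auto simp: D_def Rn_def)
    ultimately show "\<exists>D. finite D \<and> D \<subseteq> Rn (Suc m) \<and>
       (\<forall>x\<in>Rn n. \<forall>b\<in>B. \<forall>y\<in>frontier {y. X b (x @ [y])}. \<exists>d\<in>D. pt d x y)" by blast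
  qed
qed

text \<open>This cuts each vertical line separately: whether a given cell lies inside or outside
  \<open>X b\<close> may still change with \<open>x\<close>. Removing that dependence is the task of
  the induction in \<open>cell_cover\<close>.\<close>

lemma interval_cells:
  assumes X: "drel m (Suc n) X"
  obtains w I where "drel w (Suc n) I"
    "\<And>B. finite B \<Longrightarrow> B \<subseteq> Rn m \<Longrightarrow> \<exists>D. finite D \<and> D \<subseteq> Rn w \<and>
       (\<forall>x\<in>Rn n. \<forall>y. \<exists>d\<in>D. I d (x @ [y]) \<and>
         (\<forall>b\<in>B. (\<forall>z. I d (x @ [z]) \<longrightarrow> X b (x @ [z])) \<or> (\<forall>z. I d (x @ [z]) \<longrightarrow> \<not> X b (x @ [z]))))"
proof -
  obtain w pt where pt:
    "\<And>t s r. dvec w t \<Longrightarrow> dvec n s \<Longrightarrow> dterm r \<Longrightarrow> dpred (\<lambda>v. pt (t v) (s v) (r v))"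
    and single: "\<And>d x y z. pt d x y \<Longrightarrow> pt d x z \<Longrightarrow> y = z"
    and cover: "\<And>B. finite B \<Longrightarrow> B \<subseteq> Rn m \<Longrightarrow> \<exists>D. finite D \<and> D \<subseteq> Rn w \<and>
       (\<forall>x\<in>Rn n. \<forall>b\<in>B. \<forall>y\<in>frontier {y. X b (x @ [y])}. \<exists>d\<in>D. pt d x y)"
    by (rule frontier_points[OF X]) (rule that)
  txt \<open>The first two parameters select the shape of the cell: a point, or an interval
    with or without a lower and an upper end point.\<close>
  define J where "J i j d d' x y \<longleftrightarrow>
      (i = 0 \<or> (i = 1 \<and> (\<exists>z. pt d x z \<and> z < y)) \<or> (i = 2 \<and> pt d x y)) \<and>
      (j = 0 \<or> (j = 1 \<and> (\<exists>z. pt d' x z \<and> y < z)))" for i j :: real and d d' x y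
  define I where "I p xy = J (p ! 0) (p ! 1) (take w (drop 2 p)) (drop (2 + w) p) (take n xy) (xy ! n)"
    for p xy
  show thesis
  proof (rule that[of "2 + w + w" I])
    show "drel (2 + w + w) (Suc n) I"
      unfolding drel_def I_def J_def
      by (intro dpred_intros pt dterm_const dterm_nth dvec_take dvec_drop dvec_map, simp_all) simp_all?
    fix B assume B: "finite B" "B \<subseteq> Rn m"
    obtain D0 where D0: "finite D0" "D0 \<subseteq> Rn w"
       "\<forall>x\<in>Rn n. \<forall>b\<in>B. \<forall>y\<in>frontier {y. X b (x @ [y])}. \<exists>d\<in>D0. pt d x y"
      using cover[OF B] by blast
    \<comment> \<open>A dummy parameter fills the slot of a missing end point, even when
      \<open>D0\<close> is empty. A point that it may add to \<open>Q\<close> only refines the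
      partition.\<close>
    define D1 where "D1 = insert (replicate w 0) D0"
    define D where "D = (\<lambda>(i, j, d, d'). i # j # d @ d') ` ({0, 1, 2} \<times> {0, 1} \<times> D1 \<times> D1)"
    have fin: "finite D1" "D1 \<subseteq> Rn w" using D0 by (auto simp: D1_def Rn_def)
    have "\<exists>d\<in>D. I d (x @ [y]) \<and>
         (\<forall>b\<in>B. (\<forall>z. I d (x @ [z]) \<longrightarrow> X b (x @ [z])) \<or> (\<forall>z. I d (x @ [z]) \<longrightarrow> \<not> X b (x @ [z])))"
      if x: "x \<in> Rn n" for x y
    proof -
      define good where "good T \<longleftrightarrow> y \<in> T \<and>
        (\<forall>b\<in>B. (\<forall>z\<in>T. X b (x @ [z])) \<or> (\<forall>z\<in>T. \<not> X b (x @ [z])))" for T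
      have I_J: "I (i # j # d @ d') (x @ [z]) = J i j d d' x z" if "d \<in> D1" for i j d d' z
        using that x fin(2) by (auto simp: I_def Rn_def)
      have *: ?thesis if "good {z. J i j d d' x z}" "i \<in> {0, 1, 2}" "j \<in> {0, 1}" "d \<in> D1" "d' \<in> D1" for i j d d'
      proof (rule bexI[of _ "i # j # d @ d'"])
        show "i # j # d @ d' \<in> D" using that(2-5) unfolding D_def by (intro image_eqI[of _ _ "(i, j, d, d')"]) auto
      qed (use that(1,4) in \<open>simp add: I_J good_def\<close>)
      define Q where "Q = {y. \<exists>d\<in>D1. pt d x y}"
      have "Q \<subseteq> (\<lambda>d. THE y. pt d x y) ` D1"
        unfolding Q_def by (auto intro!: image_eqI the_equality[symmetric] dest: single)
      then have "finite Q" using fin(1) finite_surj by blast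
      have r: "replicate w 0 \<in> D1" by (simp add: D1_def)
      show ?thesis
      proof (cases "y \<in> Q")
        case True
        then obtain d where d: "d \<in> D1" "pt d x y" by (auto simp: Q_def)
        then have "{z. J 2 0 d d x z} = {y}" by (auto simp: J_def dest: single)
        then have "good {z. J 2 0 d d x z}" by (auto simp: good_def)
        then show ?thesis using d by (intro *) auto
      next
        case False
        obtain T where T: "connected T" "y \<in> T" "T \<inter> Q = {}"
          "T = UNIV \<or> (\<exists>l\<in>Q. T = {l<..}) \<or> (\<exists>u\<in>Q. T = {..<u}) \<or> (\<exists>l\<in>Q. \<exists>u\<in>Q. T = {l<..<u})"
          using finite_interval_around[OF \<open>finite Q\<close> False] by blast
        have "good T" unfolding good_def
        proof (intro conjI ballI)
          fix b assume "b \<in> B"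
          then have "frontier {y. X b (x @ [y])} \<subseteq> Q" using D0(3) x by (auto simp: Q_def D1_def)
          then have "T \<inter> frontier {y. X b (x @ [y])} = {}" using T(3) by blast
          then have "T \<inter> {y. X b (x @ [y])} = {} \<or> T - {y. X b (x @ [y])} = {}"
            using connected_Int_frontier[OF T(1), of "{y. X b (x @ [y])}"] by argo
          then show "(\<forall>z\<in>T. X b (x @ [z])) \<or> (\<forall>z\<in>T. \<not> X b (x @ [z]))" by blast
        qed (rule T(2))
        moreover have "\<exists>i\<in>{0, 1, 2}. \<exists>j\<in>{0, 1}. \<exists>d\<in>D1. \<exists>d'\<in>D1. T = {z. J i j d d' x z}"
          using T(4)
        proof (elim disjE bexE)
          assume "T = UNIV"
          then have "T = {z. J 0 0 (replicate w 0) (replicate w 0) x z}" by (simp add: J_def)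
          then show ?thesis using r by blast
        next
          fix l assume l: "l \<in> Q" "T = {l<..}"
          then obtain d where "d \<in> D1" "pt d x l" by (auto simp: Q_def)
          moreover from this have "T = {z. J 1 0 d d x z}" using l by (auto simp: J_def dest: single)
          ultimately show ?thesis by blast
        next
          fix l assume l: "l \<in> Q" "T = {..<l}"
          then obtain d where "d \<in> D1" "pt d x l" by (auto simp: Q_def)
          moreover from this have "T = {z. J 0 1 d d x z}" using l by (auto simp: J_def dest: single)
          ultimately show ?thesis by blast
        next
          fix l u assume l: "l \<in> Q" "u \<in> Q" "T = {l<..<u}"
          then obtain d d' where "d \<in> D1" "pt d x l" "d' \<in> D1" "pt d' x u" by (auto simp: Q_def)
          moreover from this have "T = {z. J 1 1 d d' x z}" using l by (auto simp: J_def dest: single)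
          ultimately show ?thesis by blast
        qed
        ultimately obtain i j d d' where "good {z. J i j d d' x z}" "i \<in> {0, 1, 2}" "j \<in> {0, 1}"
            "d \<in> D1" "d' \<in> D1" by blast
        then show ?thesis by (rule *)
      qed
    qed
    moreover have "finite D" "D \<subseteq> Rn (2 + w + w)" using fin by (auto simp: D_def Rn_def subset_iff)
    ultimately show "\<exists>D. finite D \<and> D \<subseteq> Rn (2 + w + w) \<and>
       (\<forall>x\<in>Rn n. \<forall>y. \<exists>d\<in>D. I d (x @ [y]) \<and>
         (\<forall>b\<in>B. (\<forall>z. I d (x @ [z]) \<longrightarrow> X b (x @ [z])) \<or> (\<forall>z. I d (x @ [z]) \<longrightarrow> \<not> X b (x @ [z]))))"
      by blast
  qed
qed

text \<open>The cells are fibres of one definable family that does not depend on the number of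
  given sets; only the finite set of parameters does.\<close>

theorem cell_cover:
  assumes "drel m n X"
  shows "\<exists>p \<Psi>. drel p n \<Psi> \<and> (\<forall>B. finite B \<and> B \<subseteq> Rn m \<longrightarrow>
    (\<exists>C. finite C \<and> C \<subseteq> Rn p \<and> (\<forall>x\<in>Rn n. \<exists>c\<in>C. \<Psi> c x) \<and>
      (\<forall>c\<in>C. \<forall>b\<in>B. (\<forall>x\<in>Rn n. \<Psi> c x \<longrightarrow> X b x) \<or> (\<forall>x\<in>Rn n. \<Psi> c x \<longrightarrow> \<not> X b x))))"
  using assms
proof (induction n arbitrary: m X)
  case 0
  have "drel 0 0 (\<lambda>c x. True)" unfolding drel_def by (rule dpred_const)
  then show ?case
    by (intro exI[of _ 0] exI[of _ "\<lambda>c x. True"] conjI allI impI exI[of _ "{[]}"]) (auto simp: Rn_def)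
next
  case (Suc n)
  obtain w I where I: "drel w (Suc n) I" and cover:
    "\<And>B. finite B \<Longrightarrow> B \<subseteq> Rn m \<Longrightarrow> \<exists>D. finite D \<and> D \<subseteq> Rn w \<and>
       (\<forall>x\<in>Rn n. \<forall>y. \<exists>d\<in>D. I d (x @ [y]) \<and>
         (\<forall>b\<in>B. (\<forall>z. I d (x @ [z]) \<longrightarrow> X b (x @ [z])) \<or> (\<forall>z. I d (x @ [z]) \<longrightarrow> \<not> X b (x @ [z]))))"
    by (rule interval_cells[OF Suc.prems]) (rule that)
  define inside where "inside b d x \<longleftrightarrow> (\<forall>z. I d (x @ [z]) \<longrightarrow> X b (x @ [z]))" for b d x
  define outside where "outside b d x \<longleftrightarrow> (\<forall>z. I d (x @ [z]) \<longrightarrow> \<not> X b (x @ [z]))" for b d x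
  \<comment> \<open>Both kinds of conditions on the base point are put into one family over
    \<open>Rn n\<close>, selected by the first parameter, so that the cells from a single use of the
    induction hypothesis respect all of them.\<close>
  define Y where "Y q x \<longleftrightarrow> (q ! 0 = 0 \<and> inside (take m (drop 1 q)) (drop (1 + m) q) x) \<or>
      (q ! 0 \<noteq> 0 \<and> outside (take m (drop 1 q)) (drop (1 + m) q) x)" for q x
  have "drel (1 + m + w) n Y"
    unfolding drel_def Y_def inside_def outside_def
    by (intro dpred_intros drel_subst[OF I] drel_subst[OF Suc.prems] dvec_snoc dterm_const dterm_nth
        dvec_take dvec_drop dvec_map, simp_all) simp_all?
  from Suc.IH[OF this] obtain p \<Psi> where \<Psi>: "drel p n \<Psi>" and cells:
    "\<forall>B. finite B \<and> B \<subseteq> Rn (1 + m + w) \<longrightarrow>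
      (\<exists>C. finite C \<and> C \<subseteq> Rn p \<and> (\<forall>x\<in>Rn n. \<exists>c\<in>C. \<Psi> c x) \<and>
      (\<forall>c\<in>C. \<forall>b\<in>B. (\<forall>x\<in>Rn n. \<Psi> c x \<longrightarrow> Y b x) \<or> (\<forall>x\<in>Rn n. \<Psi> c x \<longrightarrow> \<not> Y b x)))"
    by (elim exE conjE) (rule that)
  define \<Phi> where "\<Phi> q xy \<longleftrightarrow> \<Psi> (take p q) (take n xy) \<and> I (drop p q) xy" for q xy
  show ?case
  proof (intro exI[of _ "p + w"] exI[of _ \<Phi>] conjI allI impI)
    show "drel (p + w) (Suc n) \<Phi>"
      unfolding drel_def \<Phi>_def
      by (intro dpred_intros drel_subst[OF I] drel_subst[OF \<Psi>] dvec_take dvec_drop dvec_map, simp_all) simp_all?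
    fix B assume B: "finite B \<and> B \<subseteq> Rn m"
    then obtain D where D: "finite D" "D \<subseteq> Rn w"
       "\<And>x y. x \<in> Rn n \<Longrightarrow> \<exists>d\<in>D. I d (x @ [y]) \<and> (\<forall>b\<in>B. inside b d x \<or> outside b d x)"
      using cover[of B] unfolding inside_def outside_def by metis
    define BD where "BD = (\<lambda>(i, b, d). i # b @ d) ` ({0, 1} \<times> B \<times> D)"
    have "finite BD" "BD \<subseteq> Rn (1 + m + w)" using B D by (auto simp: BD_def Rn_def subset_iff)
    then obtain C where C: "finite C" "C \<subseteq> Rn p" "\<And>x. x \<in> Rn n \<Longrightarrow> \<exists>c\<in>C. \<Psi> c x"
      "\<And>c b. c \<in> C \<Longrightarrow> b \<in> BD \<Longrightarrow> (\<forall>x\<in>Rn n. \<Psi> c x \<longrightarrow> Y b x) \<or> (\<forall>x\<in>Rn n. \<Psi> c x \<longrightarrow> \<not> Y b x)"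
      using cells[rule_format, of BD] by auto
    have uncrossed: "(\<forall>x\<in>Rn n. \<Psi> c x \<longrightarrow> inside b d x) \<or> (\<forall>x\<in>Rn n. \<Psi> c x \<longrightarrow> \<not> inside b d x)"
      "(\<forall>x\<in>Rn n. \<Psi> c x \<longrightarrow> outside b d x) \<or> (\<forall>x\<in>Rn n. \<Psi> c x \<longrightarrow> \<not> outside b d x)"
      if "c \<in> C" "b \<in> B" "d \<in> D" for c b d
    proof -
      have "0 # b @ d \<in> BD" "1 # b @ d \<in> BD" using that by (force simp: BD_def)+
      moreover have "length b = m" using that B by (auto simp: Rn_def)
      then have "Y (0 # b @ d) x = inside b d x" "Y (1 # b @ d) x = outside b d x" for x
        by (simp_all add: Y_def)
      ultimately show "(\<forall>x\<in>Rn n. \<Psi> c x \<longrightarrow> inside b d x) \<or> (\<forall>x\<in>Rn n. \<Psi> c x \<longrightarrow> \<not> inside b d x)"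
      "(\<forall>x\<in>Rn n. \<Psi> c x \<longrightarrow> outside b d x) \<or> (\<forall>x\<in>Rn n. \<Psi> c x \<longrightarrow> \<not> outside b d x)"
        using C(4)[OF that(1)] by metis+
    qed
    \<comment> \<open>Pairs whose position relative to some \<open>X b\<close> varies over the base
      cell are discarded. The rest still covers: at a single point \<open>x\<close> of
      \<open>c\<close> the chosen interval is inside or outside \<open>X b\<close>, and
      \<open>uncrossed\<close> spreads this over all of \<open>c\<close>.\<close>
    define CD where "CD = {(c, d) \<in> C \<times> D. \<forall>b\<in>B.
        (\<forall>x\<in>Rn n. \<Psi> c x \<longrightarrow> inside b d x) \<or> (\<forall>x\<in>Rn n. \<Psi> c x \<longrightarrow> outside b d x)}"
    have \<Phi>_eq: "\<Phi> (c @ d) (x @ [y]) \<longleftrightarrow> \<Psi> c x \<and> I d (x @ [y])" if "c \<in> C" "x \<in> Rn n" for c d x y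
      using that C(2) by (auto simp: \<Phi>_def Rn_def)
    let ?C = "(\<lambda>(c, d). c @ d) ` CD"
    show "\<exists>C. finite C \<and> C \<subseteq> Rn (p + w) \<and> (\<forall>x\<in>Rn (Suc n). \<exists>c\<in>C. \<Phi> c x) \<and>
      (\<forall>c\<in>C. \<forall>b\<in>B. (\<forall>x\<in>Rn (Suc n). \<Phi> c x \<longrightarrow> X b x) \<or> (\<forall>x\<in>Rn (Suc n). \<Phi> c x \<longrightarrow> \<not> X b x))"
    proof (intro exI[of _ ?C] conjI)
      have "CD \<subseteq> C \<times> D" by (auto simp: CD_def)
      then show "finite ?C" using C(1) D(1) by (meson finite_SigmaI finite_imageI finite_subset)
      show "?C \<subseteq> Rn (p + w)" using \<open>CD \<subseteq> C \<times> D\<close> C(2) D(2) by (auto simp: Rn_def subset_iff)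
      show "\<forall>x\<in>Rn (Suc n). \<exists>c\<in>?C. \<Phi> c x"
        unfolding Rn_Suc_snoc
      proof (intro ballI allI)
        fix x y assume x: "x \<in> Rn n"
        obtain c where c: "c \<in> C" "\<Psi> c x" using C(3)[OF x] by blast
        obtain d where d: "d \<in> D" "I d (x @ [y])" "\<forall>b\<in>B. inside b d x \<or> outside b d x"
          using D(3)[OF x] by blast
        have "(c, d) \<in> CD" unfolding CD_def using c d x uncrossed[OF c(1) _ d(1)] by blast
        then show "\<exists>c\<in>?C. \<Phi> c (x @ [y])"
          using c d x by (intro bexI[of _ "c @ d"]) (auto simp: \<Phi>_eq)
      qed
      show "\<forall>c\<in>?C. \<forall>b\<in>B. (\<forall>x\<in>Rn (Suc n). \<Phi> c x \<longrightarrow> X b x) \<or> (\<forall>x\<in>Rn (Suc n). \<Phi> c x \<longrightarrow> \<not> X b x)"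
      proof (intro ballI)
        fix q b assume "q \<in> ?C" and b: "b \<in> B"
        then obtain c d where cd: "q = c @ d" "(c, d) \<in> CD" by auto
        then have "c \<in> C" by (auto simp: CD_def)
        have "(\<forall>x\<in>Rn n. \<Psi> c x \<longrightarrow> inside b d x) \<or> (\<forall>x\<in>Rn n. \<Psi> c x \<longrightarrow> outside b d x)"
          using cd b by (auto simp: CD_def)
        then show "(\<forall>x\<in>Rn (Suc n). \<Phi> q x \<longrightarrow> X b x) \<or> (\<forall>x\<in>Rn (Suc n). \<Phi> q x \<longrightarrow> \<not> X b x)"
          unfolding Rn_Suc_snoc cd(1) using \<Phi>_eq[OF \<open>c \<in> C\<close>] by (auto simp: inside_def outside_def)
      qed
    qed
  qed
qed

end

section \<open>Uniform polynomial bounds\<close>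

text \<open>Suited to dyadic iteration: the lower bound 1 gives a positive starting value, and
  monotonicity controls \<open>h\<close> between consecutive powers of 2.\<close>

definition growth :: "(real \<Rightarrow> real) \<Rightarrow> bool" where
  "growth h \<longleftrightarrow> (\<forall>s. 0 < s \<longrightarrow> 1 \<le> h s) \<and> (\<forall>s. \<forall>s'. 0 < s \<and> s \<le> s' \<longrightarrow> h s \<le> h s')"

lemma doubling_upper:
  fixes h :: "real \<Rightarrow> real"
  assumes "\<And>s. s0 \<le> s \<Longrightarrow> h (2 * s) \<le> K * h s" "0 \<le> K" "0 < s0" "s0 \<le> s"
  shows "h (2 ^ j * s) \<le> K ^ j * h s"
proof (induction j)
  case (Suc j)
  have "s0 \<le> 2 ^ j * s" using assms(3,4) mult_mono[of 1 "2 ^ j" s0 s] by simp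
  then have "h (2 * (2 ^ j * s)) \<le> K * h (2 ^ j * s)" by (rule assms(1))
  also have "\<dots> \<le> K * (K ^ j * h s)" using Suc assms(2) by (rule mult_left_mono)
  finally show ?case by (simp add: mult.assoc)
qed simp

lemma doubling_lower:
  fixes h :: "real \<Rightarrow> real"
  assumes "\<And>s. s0 \<le> s \<Longrightarrow> K * h s \<le> h (2 * s)" "0 \<le> K" "0 < s0" "s0 \<le> s"
  shows "K ^ j * h s \<le> h (2 ^ j * s)"
  using doubling_upper[of s0 "\<lambda>s. - h s" K s j] assms by simp

text \<open>Iterating from a fixed \<open>s0\<close> would give \<open>2 ^ ((N + 1) * j) \<le> h (2
  ^ j * s0) < 2 ^ (N * j) * s0 ^ N\<close>, which fails once \<open>2 ^ j\<close> exceeds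
  \<open>s0 ^ N\<close>.\<close>

lemma doubling_of_poly_bound:
  assumes h: "growth h" and poly: "\<And>s. c < s \<Longrightarrow> \<bar>h s\<bar> < s ^ N"
  shows "\<not> eventually (\<lambda>s. 2 ^ Suc N * h s < h (2 * s)) at_top"
proof
  assume "eventually (\<lambda>s. 2 ^ Suc N * h s < h (2 * s)) at_top"
  then obtain s1 where s1: "\<And>s. s1 < s \<Longrightarrow> 2 ^ Suc N * h s < h (2 * s)"
    unfolding eventually_at_top_dense by blast
  define s0 where "s0 = max 1 (max s1 c) + 1"
  have s0: "1 < s0" "s1 < s0" "c < s0" by (auto simp: s0_def)
  obtain j where j: "s0 ^ N < 2 ^ j" using real_arch_pow[of 2 "s0 ^ N"] by auto
  have ge: "s0 \<le> 2 ^ j * s0" using s0 mult_mono[of 1 "2 ^ j" s0 s0] by simp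
  have "(2 ^ Suc N) ^ j * h s0 \<le> h (2 ^ j * s0)"
    by (rule doubling_lower[of s0]) (use s0 s1 in \<open>auto intro!: less_imp_le\<close>)
  moreover have "(2 ^ Suc N) ^ j * 1 \<le> (2 ^ Suc N) ^ j * h s0"
    using h s0 unfolding growth_def by (intro mult_left_mono) auto
  moreover have "h (2 ^ j * s0) < (2 ^ j * s0) ^ N" using poly[of "2 ^ j * s0"] s0 ge by simp
  ultimately have "(2 ^ Suc N) ^ j < (2 ^ j * s0) ^ N" by linarith
  also have "\<dots> = (2 ^ N) ^ j * s0 ^ N"
    by (simp add: power_mult_distrib power_mult[symmetric] mult.commute)
  also have "\<dots> < (2 ^ N) ^ j * 2 ^ j" using j by simp
  finally show False by (simp add: power_mult_distrib mult.commute)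
qed

text \<open>On the range from \<open>s0\<close> to \<open>2 * s0\<close> monotonicity bounds
  \<open>h\<close> by the constant \<open>C\<close>; halving the argument carries the bound
  \<open>C * s ^ M\<close> to all larger \<open>s\<close>. The additional power of \<open>s\<close>
  absorbs \<open>C\<close>.\<close>

lemma poly_bound_of_doubling:
  assumes h: "growth h" and dbl: "eventually (\<lambda>s. h (2 * s) \<le> 2 ^ M * h s) at_top"
  shows "eventually (\<lambda>s. h s \<le> s ^ Suc M) at_top"
proof -
  obtain s1 where s1: "\<And>s. s1 < s \<Longrightarrow> h (2 * s) \<le> 2 ^ M * h s"
    using dbl unfolding eventually_at_top_dense by blast
  define s0 where "s0 = max 1 s1 + 1"
  have s0: "1 < s0" "s1 < s0" by (auto simp: s0_def)
  have ge1: "1 \<le> h s" and mono: "s \<le> s' \<Longrightarrow> h s \<le> h s'" if "0 < s" for s s'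
    using h that unfolding growth_def by auto
  define C where "C = h (2 * s0)"
  have C: "1 \<le> C" using ge1[of "2 * s0"] s0 by (simp add: C_def)
  have "h s \<le> C * s ^ M" if "s0 \<le> s" "s \<le> 2 ^ k * s0" for k s
    using that
  proof (induction k arbitrary: s)
    case 0
    then have "h s \<le> C * 1" using mono[of s "2 * s0"] s0 by (simp add: C_def)
    also have "\<dots> \<le> C * s ^ M" using C 0 s0 by (intro mult_left_mono one_le_power) auto
    finally show ?case .
  next
    case (Suc k)
    show ?case
    proof (cases "s \<le> 2 * s0")
      case True
      then have "h s \<le> C * 1" using mono[of s "2 * s0"] s0 Suc.prems by (simp add: C_def)
      also have "\<dots> \<le> C * s ^ M" using C Suc.prems s0 by (intro mult_left_mono one_le_power) auto
      finally show ?thesis .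
    next
      case False
      have "h s \<le> 2 ^ M * h (s / 2)" using s1[of "s / 2"] False s0 by simp
      also have "\<dots> \<le> 2 ^ M * (C * (s / 2) ^ M)"
        using Suc.IH[of "s / 2"] False Suc.prems by (intro mult_left_mono) auto
      finally show ?thesis by (simp add: power_divide)
    qed
  qed
  then have bound: "h s \<le> C * s ^ M" if "s0 \<le> s" for s
  proof -
    obtain k where "s / s0 < 2 ^ k" using real_arch_pow[of 2 "s / s0"] by auto
    then have "s \<le> 2 ^ k * s0" using s0 by (simp add: field_simps)
    with that show ?thesis by (rule \<open>\<And>s k. s0 \<le> s \<Longrightarrow> s \<le> 2 ^ k * s0 \<Longrightarrow> h s \<le> C * s ^ M\<close>)
  qed
  have "h s \<le> s ^ Suc M" if "max s0 C < s" for s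
  proof -
    have "h s \<le> C * s ^ M" using that by (intro bound) simp
    also have "\<dots> \<le> s * s ^ M" using that s0 by (intro mult_right_mono) auto
    finally show ?thesis by simp
  qed
  then show ?thesis unfolding eventually_at_top_dense by blast
qed

section \<open>Eventual polynomial bounds uniform in the parameters\<close>

context o_minimal
begin

lemma poly_bound_dterm:
  assumes "polynomially_bounded Sig" "dterm (\<lambda>v. h (v 0))"
  obtains N :: nat and c where "\<And>x. c < x \<Longrightarrow> \<bar>h x\<bar> < x ^ N"
proof -
  have "{l \<in> Rn 2. l ! 1 = h (l ! 0)} \<in> Sig 2"
    by (rule Sig_Collect) (use dpred_eq[OF dterm_var[of 1] assms(2)] in simp)
  moreover have "{l \<in> Rn 2. l ! 1 = h (l ! 0)} = {[x, h x] | x. True}"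
    by (auto simp: Rn_def numeral_2_eq_2 length_Suc_conv)
  ultimately have "definable_fun1 Sig h" by (simp add: definable_fun1_def)
  then show thesis using assms(1) that unfolding polynomially_bounded_def by meson
qed

text \<open>Exponents are controlled through the doubling ratio. By o-minimality the comparison of
  \<open>h c (2 * s)\<close> with \<open>K * h c s\<close> is eventually decided, so without a
  common bound every \<open>\<mu>\<close> is eventually exceeded by the ratio of some
  \<open>c\<close>. That \<open>c\<close> varies with \<open>\<mu>\<close>; an infimum over all
  admissible \<open>c\<close>, expressed as the supremum of its lower bounds, is definable without
  selecting one.\<close>

theorem uniform_poly_bound:
  assumes pb: "polynomially_bounded Sig"
    and dh: "\<And>t s. dvec p t \<Longrightarrow> dterm s \<Longrightarrow> dterm (\<lambda>v. h (t v) (s v))"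
  shows "\<exists>N. \<forall>c\<in>Rn p. growth (h c) \<longrightarrow> eventually (\<lambda>s. h c s \<le> s ^ N) at_top"
proof -
  have const: "dvec p (\<lambda>v. c)" if "c \<in> Rn p" for c
    using that by (intro dvec_const) (simp add: Rn_def)
  have dichotomy: "eventually (\<lambda>s. h c (2 * s) \<le> K * h c s) at_top \<or>
      eventually (\<lambda>s. K * h c s < h c (2 * s)) at_top" if "c \<in> Rn p" for c K
  proof -
    have "dpred (\<lambda>v. h c (2 * v 0) \<le> K * h c (v 0))"
      by (intro dpred_intros dh const[OF that] dterm_const)
    from definable_eventually_at_top[OF this] show ?thesis by (simp add: not_le)
  qed
  have bounded_ratio: "\<exists>K\<ge>0. eventually (\<lambda>s. h c (2 * s) \<le> K * h c s) at_top"
    if c: "c \<in> Rn p" "growth (h c)" for c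
  proof -
    obtain N x0 where "\<And>x. x0 < x \<Longrightarrow> \<bar>h c x\<bar> < x ^ N"
      by (rule poly_bound_dterm[OF pb dh[OF const[OF c(1)] dterm_var[of 0]]]) (rule that)
    from doubling_of_poly_bound[OF c(2) this] dichotomy[OF c(1), of "2 ^ Suc N"] show ?thesis
      by (intro exI[of _ "2 ^ Suc N"]) simp
  qed
  have "\<exists>\<Lambda>. \<forall>c\<in>Rn p. growth (h c) \<longrightarrow> eventually (\<lambda>s. h c (2 * s) \<le> \<Lambda> * h c s) at_top"
  proof (rule ccontr)
    assume "\<nexists>\<Lambda>. \<forall>c\<in>Rn p. growth (h c) \<longrightarrow> eventually (\<lambda>s. h c (2 * s) \<le> \<Lambda> * h c s) at_top"
    then have unbdd: "\<exists>c\<in>Rn p. growth (h c) \<and> eventually (\<lambda>s. \<mu> * h c s < h c (2 * s)) at_top" for \<mu>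
      using dichotomy by blast
    txt \<open>Minimising over \<open>c\<close> the ratio \<open>h c (\<mu> * s) / h c s\<close> gives a definable function of \<open>\<mu>\<close>
      that is at least \<open>\<mu> ^ j\<close> at \<open>\<mu> = 2 ^ j\<close>.\<close>
    define Z where "Z \<mu> w \<longleftrightarrow> (\<forall>K. (\<exists>c\<in>Rn p. growth (h c) \<and>
        (\<exists>a. \<forall>s. a < s \<longrightarrow> \<mu> * h c s < h c (2 * s)) \<and>
        (\<exists>a. \<forall>s. a < s \<longrightarrow> h c (\<mu> * s) \<le> K * h c s)) \<longrightarrow> w \<le> K)" for \<mu> w
    have dsup_Z: "dterm (\<lambda>v. dsup {w. Z (v 0) w})"
      unfolding Z_def growth_def
      by (intro dterm_dsup dpred_intros dh dterm_const dvec_map) simp_all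
    obtain N x0 where poly: "\<And>\<mu>. x0 < \<mu> \<Longrightarrow> \<bar>dsup {w. Z \<mu> w}\<bar> < \<mu> ^ N"
      by (rule poly_bound_dterm[OF pb dsup_Z]) (rule that)
    obtain j0 where j0: "x0 < 2 ^ j0" using real_arch_pow[of 2 x0] by auto
    \<comment> \<open>\<open>j0\<close> puts \<open>\<mu> = 2 ^ j\<close> beyond the threshold
      \<open>x0\<close>, and \<open>N \<le> j\<close> lets \<open>\<mu> ^ j\<close> contradict the
      bound \<open>\<mu> ^ N\<close>.\<close>
    define j where "j = max j0 N"
    define \<mu> :: real where "\<mu> = 2 ^ j"
    have "(2::real) ^ j0 \<le> 2 ^ j" by (intro power_increasing) (auto simp: j_def)
    then have \<mu>: "x0 < \<mu>" "1 \<le> \<mu>" using less_le_trans[OF j0] by (simp_all add: \<mu>_def)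
    have lower: "Z \<mu> (\<mu> ^ j)" unfolding Z_def
    proof (intro allI impI, elim bexE conjE exE)
      fix K c a b assume c: "c \<in> Rn p" "growth (h c)" "\<forall>s. a < s \<longrightarrow> \<mu> * h c s < h c (2 * s)"
        "\<forall>s. b < s \<longrightarrow> h c (\<mu> * s) \<le> K * h c s"
      define s where "s = max 1 (max a b) + 1"
      have s: "0 < s" "a < s" "b < s" by (auto simp: s_def)
      have "\<mu> ^ j * h c s \<le> h c (2 ^ j * s)"
        by (rule doubling_lower[of s]) (use c(3) s \<mu> in \<open>auto intro!: less_imp_le\<close>)
      also have "\<dots> \<le> K * h c s" using c(4) s by (simp add: \<mu>_def)
      finally show "\<mu> ^ j \<le> K" using c(2) s(1) unfolding growth_def
        by (metis less_le_trans mult_le_cancel_right_pos zero_less_one)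
    qed
    \<comment> \<open>One admissible parameter with a finite ratio bound \<open>K\<close> bounds
      every \<open>w\<close> above. Without this, \<open>dsup\<close> would return its default 0 and
      the contradiction would be lost.\<close>
    obtain c where c: "c \<in> Rn p" "growth (h c)" "eventually (\<lambda>s. \<mu> * h c s < h c (2 * s)) at_top"
      using unbdd by blast
    obtain K where K: "0 \<le> K" "eventually (\<lambda>s. h c (2 * s) \<le> K * h c s) at_top"
      using bounded_ratio[OF c(1,2)] by blast
    then obtain a where a: "\<And>s. a < s \<Longrightarrow> h c (2 * s) \<le> K * h c s"
      unfolding eventually_at_top_dense by blast
    have "h c (\<mu> * s) \<le> K ^ j * h c s" if "max 0 a < s" for s
      unfolding \<mu>_def by (rule doubling_upper[of s]) (use a K that in auto)
    then have upper: "w \<le> K ^ j" if "Z \<mu> w" for w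
      using that c unfolding Z_def eventually_at_top_dense by blast
    have bdd: "bdd_above {w. Z \<mu> w}" using upper by (intro bdd_aboveI[of _ "K ^ j"]) simp
    have "\<mu> ^ j \<le> Sup {w. Z \<mu> w}" using lower bdd by (intro cSup_upper) auto
    also have "\<dots> = dsup {w. Z \<mu> w}" using lower bdd by (auto simp: dsup_def)
    also have "\<dots> < \<mu> ^ N" using poly[OF \<mu>(1)] by simp
    also have "\<dots> \<le> \<mu> ^ j" using \<mu>(2) by (intro power_increasing) (auto simp: j_def)
    finally show False by simp
  qed
  then obtain \<Lambda> where \<Lambda>: "\<And>c. c \<in> Rn p \<Longrightarrow> growth (h c) \<Longrightarrow> eventually (\<lambda>s. h c (2 * s) \<le> \<Lambda> * h c s) at_top"
    by blast
  obtain M where M: "\<Lambda> < 2 ^ M" using real_arch_pow[of 2 \<Lambda>] by auto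
  have "eventually (\<lambda>s. h c s \<le> s ^ Suc M) at_top" if c: "c \<in> Rn p" "growth (h c)" for c
  proof (rule poly_bound_of_doubling[OF c(2)])
    show "eventually (\<lambda>s. h c (2 * s) \<le> 2 ^ M * h c s) at_top"
      using \<Lambda>[OF c] eventually_gt_at_top[of 0]
    proof eventually_elim
      case (elim s)
      have "\<Lambda> * h c s \<le> 2 ^ M * h c s"
        using M c(2) elim(2) unfolding growth_def by (intro mult_right_mono) force+
      then show ?case using elim(1) by simp
    qed
  qed
  then show ?thesis by blast
qed

text \<open>Applied to the plane sets of all pairs \<open>(f x, g x)\<close>, \<open>x\<close> in a cell.\<close>

lemma uniform_planar_inequality:
  assumes pb: "polynomially_bounded Sig"
    and dW: "\<And>t y z. dvec p t \<Longrightarrow> dterm y \<Longrightarrow> dterm z \<Longrightarrow> dpred (\<lambda>v. W (t v) (y v) (z v))"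
  shows "\<exists>N>0. \<forall>c\<in>Rn p. (\<exists>M. \<forall>y z. W c y z \<longrightarrow> \<bar>z\<bar> \<le> M) \<and>
      (\<forall>t>0. \<exists>\<delta>>0. \<forall>y z. W c y z \<and> t \<le> \<bar>z\<bar> \<longrightarrow> \<delta> \<le> \<bar>y\<bar>) \<longrightarrow>
      (\<exists>C. \<forall>y z. W c y z \<longrightarrow> \<bar>z\<bar> ^ N \<le> C * \<bar>y\<bar>)"
proof -
  \<comment> \<open>The element 1 keeps the set nonempty and forces \<open>1 \<le> h c s\<close>, as
    \<open>growth\<close> requires.\<close>
  define T where "T c s = {r. r = 1 \<or> (\<exists>y z. W c y z \<and> 1 \<le> \<bar>z\<bar> * s \<and> r = 1 / \<bar>y\<bar>)}" for c s
  define h where "h c s = dsup (T c s)" for c s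
  have dh: "dterm (\<lambda>v. h (t v) (s v))" if "dvec p t" "dterm s" for t s
  proof -
    have "dvec p (\<lambda>v. t (\<lambda>i. v (\<sigma> i)))" "dterm (\<lambda>v. s (\<lambda>i. v (\<sigma> i)))" for \<sigma>
      using that dterm_reindex[where \<sigma> = \<sigma>] by (auto simp: dvec_def)
    then show ?thesis unfolding h_def T_def
      by (intro dterm_dsup dpred_intros dW dterm_const)
  qed
  obtain N where N: "\<And>c. c \<in> Rn p \<Longrightarrow> growth (h c) \<Longrightarrow> eventually (\<lambda>s. h c s \<le> s ^ N) at_top"
    using uniform_poly_bound[of p h, OF pb dh] by blast
  \<comment> \<open>The exponent is \<open>Suc N\<close> because the left side has to vanish at
    \<open>z = 0\<close>, even when \<open>N = 0\<close>.\<close>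
  have "\<exists>C. \<forall>y z. W c y z \<longrightarrow> \<bar>z\<bar> ^ Suc N \<le> C * \<bar>y\<bar>"
    if c: "c \<in> Rn p" and M: "\<And>y z. W c y z \<Longrightarrow> \<bar>z\<bar> \<le> M"
      and pos: "\<And>t. 0 < t \<Longrightarrow> \<exists>\<delta>>0. \<forall>y z. W c y z \<and> t \<le> \<bar>z\<bar> \<longrightarrow> \<delta> \<le> \<bar>y\<bar>" for c M
  proof -
    have bdd: "bdd_above (T c s)" if s: "0 < s" for s
    proof -
      obtain \<delta> where \<delta>: "0 < \<delta>" "\<And>y z. W c y z \<Longrightarrow> 1 / s \<le> \<bar>z\<bar> \<Longrightarrow> \<delta> \<le> \<bar>y\<bar>"
        using pos[of "1 / s"] s by auto
      have "r \<le> max 1 (1 / \<delta>)" if rT: "r \<in> T c s" for r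
      proof (cases "r = 1")
        case False
        then obtain y z where yz: "W c y z" "1 \<le> \<bar>z\<bar> * s" "r = 1 / \<bar>y\<bar>" using rT by (auto simp: T_def)
        then have "\<delta> \<le> \<bar>y\<bar>" using \<delta>(2)[of y z] s by (simp add: field_simps)
        then have "r \<le> 1 / \<delta>" using \<delta>(1) yz(3) by (simp add: frac_le)
        then show ?thesis by simp
      qed simp
      then show ?thesis by (intro bdd_aboveI)
    qed
    have one: "1 \<in> T c s" for s by (simp add: T_def)
    have h_eq: "h c s = Sup (T c s)" if "0 < s" for s
      using bdd[OF that] one[of s] by (auto simp: h_def dsup_def)
    have upper: "r \<le> h c s" if "0 < s" "r \<in> T c s" for r s
      using cSup_upper[OF that(2) bdd[OF that(1)]] h_eq[OF that(1)] by simp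
    have gr: "growth (h c)" unfolding growth_def
    proof (intro conjI allI impI)
      fix s :: real assume "0 < s"
      then show "1 \<le> h c s" using upper one by blast
    next
      fix s s' :: real assume s: "0 < s \<and> s \<le> s'"
      have "T c s \<subseteq> T c s'"
      proof
        fix r assume "r \<in> T c s"
        moreover have "1 \<le> \<bar>z\<bar> * s'" if "1 \<le> \<bar>z\<bar> * s" for z
          using that s mult_left_mono[of s s' "\<bar>z\<bar>"] by simp
        ultimately show "r \<in> T c s'" unfolding T_def by auto
      qed
      then show "h c s \<le> h c s'" using s bdd[of s'] one[of s] by (simp add: h_eq) (intro cSup_subset_mono, auto)
    qed
    obtain s1 where s1: "\<And>s. s1 < s \<Longrightarrow> h c s \<le> s ^ N"
      using N[OF c gr] unfolding eventually_at_top_dense by blast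
    define s0 where "s0 = max 1 s1 + 1"
    have s0: "1 < s0" "s1 < s0" by (auto simp: s0_def)
    have hs0: "1 \<le> h c s0" using upper[OF _ one] s0 by simp
    \<comment> \<open>The 1 serves small \<open>z\<close>, where the eventual bound on
      \<open>h\<close> gives \<open>\<bar>z\<bar> ^ N \<le> \<bar>y\<bar>\<close>; the other term
      serves the remaining \<open>z\<close>, where \<open>1 / \<bar>y\<bar> \<le> h c s0\<close> and
      \<open>\<bar>z\<bar> \<le> M\<close>.\<close>
    define C where "C = max 1 (\<bar>M\<bar> ^ Suc N * h c s0)"
    have "\<bar>z\<bar> ^ Suc N \<le> C * \<bar>y\<bar>" if W: "W c y z" for y z
    proof (cases "z = 0")
      case True
      then show ?thesis by (simp add: C_def)
    next
      case False
      then have z: "0 < \<bar>z\<bar>" by simp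
      obtain \<delta> where "0 < \<delta>" "\<delta> \<le> \<bar>y\<bar>" using pos[OF z] W by blast
      then have y: "0 < \<bar>y\<bar>" by simp
      show ?thesis
      proof (cases "s0 \<le> 1 / \<bar>z\<bar>")
        case True
        have "1 / \<bar>y\<bar> \<in> T c (1 / \<bar>z\<bar>)" using W z unfolding T_def by force
        then have "1 / \<bar>y\<bar> \<le> (1 / \<bar>z\<bar>) ^ N"
          using upper[of "1 / \<bar>z\<bar>" "1 / \<bar>y\<bar>"] s1[of "1 / \<bar>z\<bar>"] True s0 z by simp
        then have "\<bar>z\<bar> ^ N \<le> \<bar>y\<bar>" using y z by (simp add: power_divide field_simps)
        moreover have "\<bar>z\<bar> \<le> 1" using True s0 z by (simp add: field_simps) (smt (verit) mult_le_cancel_right2)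
        then have "\<bar>z\<bar> ^ Suc N \<le> \<bar>z\<bar> ^ N" by (intro power_decreasing) auto
        moreover have "1 * \<bar>y\<bar> \<le> C * \<bar>y\<bar>" by (intro mult_right_mono) (auto simp: C_def)
        ultimately show ?thesis by simp
      next
        case False
        then have "1 \<le> \<bar>z\<bar> * s0" using z by (simp add: field_simps)
        then have "1 / \<bar>y\<bar> \<in> T c s0" using W unfolding T_def by blast
        then have "1 / \<bar>y\<bar> \<le> h c s0" using upper s0 by simp
        then have "1 \<le> h c s0 * \<bar>y\<bar>" using y by (simp add: field_simps)
        moreover have "\<bar>z\<bar> ^ Suc N \<le> \<bar>M\<bar> ^ Suc N" using M[OF W] by (intro power_mono) auto
        ultimately have "\<bar>z\<bar> ^ Suc N * 1 \<le> \<bar>M\<bar> ^ Suc N * (h c s0 * \<bar>y\<bar>)"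
          by (intro mult_mono) auto
        also have "\<dots> \<le> C * \<bar>y\<bar>" unfolding mult.assoc[symmetric] by (intro mult_right_mono) (auto simp: C_def)
        finally show ?thesis by simp
      qed
    qed
    then show ?thesis by blast
  qed
  then show ?thesis by (intro exI[of _ "Suc N"]) auto
qed

end

section \<open>Compactness and the inequality\<close>

lemma Rn_sequence_compact:
  assumes b: "\<And>k i. i < n \<Longrightarrow> \<bar>X k ! i\<bar> \<le> (M::real)"
  shows "\<exists>r y. strict_mono (r :: nat \<Rightarrow> nat) \<and> y \<in> Rn n \<and> (\<forall>i<n. (\<lambda>k. X (r k) ! i) \<longlonglongrightarrow> y ! i)"
  using b
proof (induction n)
  case 0
  then show ?case by (intro exI[of _ id] exI[of _ "[]"]) (auto simp: Rn_def strict_mono_def)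
next
  case (Suc n)
  then obtain r y where ry: "strict_mono r" "y \<in> Rn n" "\<And>i. i < n \<Longrightarrow> (\<lambda>k. X (r k) ! i) \<longlonglongrightarrow> y ! i"
    by (metis less_SucI)
  have "bounded (range (\<lambda>k. X (r k) ! n))"
    using Suc.prems[of n] by (intro boundedI[of _ M]) auto
  then obtain l q where lq: "strict_mono q" "((\<lambda>k. X (r k) ! n) \<circ> q) \<longlonglongrightarrow> l"
    using bounded_imp_convergent_subsequence by blast
  show ?case
  proof (intro exI[of _ "r \<circ> q"] exI[of _ "y @ [l]"] conjI allI impI)
    show "strict_mono (r \<circ> q)" using ry(1) lq(1) by (rule strict_mono_o)
    show "y @ [l] \<in> Rn (Suc n)" using ry(2) by (simp add: Rn_def)
    fix i assume "i < Suc n"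
    then consider "i < n" | "i = n" by linarith
    then show "(\<lambda>k. X ((r \<circ> q) k) ! i) \<longlonglongrightarrow> (y @ [l]) ! i"
    proof cases
      case 1
      from LIMSEQ_subseq_LIMSEQ[OF ry(3)[OF 1] lq(1)] show ?thesis
        using 1 ry(2) by (simp add: o_def nth_append Rn_def)
    next
      case 2
      then show ?thesis using lq(2) ry(2) by (simp add: o_def nth_append Rn_def)
    qed
  qed
qed

text \<open>The subsequence and its limit are chosen before the function, so that \<open>f\<close>
  and \<open>g\<close> can be followed along the same subsequence.\<close>

lemma closed_bounded_Rn_compact:
  assumes "closed_Rn n S" "bounded_Rn n S" "\<And>k. X k \<in> S"
  obtains r y where "strict_mono (r :: nat \<Rightarrow> nat)" "y \<in> S" "\<And>f. continuous_on_Rn n S f \<Longrightarrow> (\<lambda>k. f (X (r k))) \<longlonglongrightarrow> f y"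
proof -
  obtain M where "\<And>k i. i < n \<Longrightarrow> \<bar>X k ! i\<bar> \<le> M" using assms(2,3) unfolding bounded_Rn_def by meson
  then obtain r y where r: "strict_mono (r :: nat \<Rightarrow> nat)" and y: "y \<in> Rn n"
      and lim: "\<forall>i<n. (\<lambda>k. X (r k) ! i) \<longlonglongrightarrow> y ! i"
    using Rn_sequence_compact[of n X M] by blast
  have "y \<in> S" using conjunct2[OF assms(1)[unfolded closed_Rn_def], THEN spec, of "\<lambda>k. X (r k)"] assms(3) y lim
    by simp
  moreover have "(\<lambda>k. f (X (r k))) \<longlonglongrightarrow> f y" if f: "continuous_on_Rn n S f" for f
  proof (rule tendstoI)
    fix e :: real assume "0 < e"
    then obtain d where d: "0 < d" "\<And>x. x \<in> S \<Longrightarrow> \<forall>i<n. \<bar>x ! i - y ! i\<bar> < d \<Longrightarrow> \<bar>f x - f y\<bar> < e"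
      using f \<open>y \<in> S\<close> unfolding continuous_on_Rn_def by meson
    have "\<forall>\<^sub>F k in sequentially. \<forall>i\<in>{..<n}. \<bar>X (r k) ! i - y ! i\<bar> < d"
    proof (rule eventually_ball_finite)
      show "\<forall>i\<in>{..<n}. \<forall>\<^sub>F k in sequentially. \<bar>X (r k) ! i - y ! i\<bar> < d"
        using lim tendstoD[OF _ d(1)] by (fastforce simp: dist_real_def)
    qed simp
    then show "\<forall>\<^sub>F k in sequentially. dist (f (X (r k))) (f y) < e"
      by eventually_elim (use d(2) assms(3) in \<open>auto simp: dist_real_def\<close>)
  qed
  ultimately show thesis using r by (intro that)
qed

lemma continuous_on_Rn_bounded:
  assumes S: "closed_Rn n S" "bounded_Rn n S" and g: "continuous_on_Rn n S g"
  shows "\<exists>M. \<forall>x\<in>S. \<bar>g x\<bar> \<le> M"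
proof (rule ccontr)
  assume "\<nexists>M. \<forall>x\<in>S. \<bar>g x\<bar> \<le> M"
  then have "\<exists>x\<in>S. real k < \<bar>g x\<bar>" for k by (meson not_le)
  then obtain X where X: "\<And>k. X k \<in> S" "\<And>k. real k < \<bar>g (X k)\<bar>" by metis
  obtain r y where r: "strict_mono (r :: nat \<Rightarrow> nat)" and "y \<in> S"
      and lim: "\<And>f. continuous_on_Rn n S f \<Longrightarrow> (\<lambda>k. f (X (r k))) \<longlonglongrightarrow> f y"
    by (rule closed_bounded_Rn_compact[OF S, of X]) (use X(1) that in auto)
  from lim[OF g] have "Bseq (\<lambda>k. g (X (r k)))" by (intro convergent_imp_Bseq convergentI)
  then obtain K where "\<And>k. \<bar>g (X (r k))\<bar> \<le> K" unfolding Bseq_def by auto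
  moreover obtain k where "K < real k" using reals_Archimedean2 by blast
  ultimately show False using X(2)[of "r k"] seq_suble[OF r, of k]
    by (meson less_le_trans not_le of_nat_le_iff order.strict_trans2 order_less_imp_le)
qed

text \<open>Points violating every \<open>\<delta>\<close> would accumulate at some \<open>y\<close>
  in \<open>S\<close> with \<open>f y = 0\<close> and \<open>t \<le> \<bar>g y\<bar>\<close>,
  against the inclusion of zero sets.\<close>

lemma continuous_on_Rn_away_from_zero:
  assumes S: "closed_Rn n S" "bounded_Rn n S" and f: "continuous_on_Rn n S f" and g: "continuous_on_Rn n S g"
    and zeros: "\<forall>x\<in>S. f x = 0 \<longrightarrow> g x = 0" and t: "0 < t"
  shows "\<exists>\<delta>>0. \<forall>x\<in>S. t \<le> \<bar>g x\<bar> \<longrightarrow> \<delta> \<le> \<bar>f x\<bar>"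
proof (rule ccontr)
  assume no: "\<not> ?thesis"
  have "\<exists>x\<in>S. t \<le> \<bar>g x\<bar> \<and> \<bar>f x\<bar> < inverse (real (Suc k))" for k
    using no[simplified, rule_format, of "inverse (real (Suc k))"] by (auto simp: not_le)
  then obtain X where X: "\<And>k. X k \<in> S" "\<And>k. t \<le> \<bar>g (X k)\<bar>" "\<And>k. \<bar>f (X k)\<bar> < inverse (real (Suc k))"
    by metis
  obtain r y where r: "strict_mono (r :: nat \<Rightarrow> nat)" and y: "y \<in> S"
      and lim: "\<And>f. continuous_on_Rn n S f \<Longrightarrow> (\<lambda>k. f (X (r k))) \<longlonglongrightarrow> f y"
    by (rule closed_bounded_Rn_compact[OF S, of X]) (use X(1) that in auto)
  have "t \<le> \<bar>g y\<bar>"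
    by (rule LIMSEQ_le_const[OF tendsto_rabs[OF lim[OF g]]]) (use X(2) in auto)
  moreover have "\<bar>f (X (r k))\<bar> \<le> inverse (real (Suc k))" for k
  proof -
    have "inverse (real (Suc (r k))) \<le> inverse (real (Suc k))"
      using seq_suble[OF r, of k] by (intro le_imp_inverse_le) auto
    then show ?thesis using X(3)[of "r k"] by linarith
  qed
  then have "(\<lambda>k. f (X (r k))) \<longlonglongrightarrow> 0"
    by (intro Lim_null_comparison[OF _ LIMSEQ_inverse_real_of_nat] always_eventually) simp
  then have "f y = 0" using lim[OF f] LIMSEQ_unique by blast
  ultimately show False using zeros y t by auto
qed

section \<open>Cells inside Boolean combinations of fibres\<close>

text \<open>Being contained in or disjoint from a set passes to complements and unions, so only the
  generators have to be checked; the complexity of the Boolean combination is irrelevant.\<close>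

lemma bool_alg_uncrossed:
  assumes "X \<in> bool_alg n (fibre Fam ` B)" "T \<subseteq> Rn n"
    "\<And>b. b \<in> B \<Longrightarrow> (\<forall>x\<in>T. b @ x \<in> Fam) \<or> (\<forall>x\<in>T. b @ x \<notin> Fam)"
  shows "T \<subseteq> X \<or> T \<inter> X = {}"
  using assms(1)
proof induction
  case (gen X)
  then obtain b where "b \<in> B" "X = {y. b @ y \<in> Fam}" by (auto simp: fibre_def)
  then show ?case using assms(3)[of b] by blast
qed (use assms(2) in blast)+

context o_minimal
begin

text \<open>The order of the quantifiers is what counts: \<open>p\<close> and \<open>\<Psi>\<close>
  come before \<open>B\<close>, so an exponent obtained from \<open>\<Psi>\<close> is independent of
  \<open>B\<close>; the finite set \<open>C\<close> comes before \<open>X\<close>, so a constant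
  obtained from \<open>C\<close> serves all \<open>X\<close>.\<close>

lemma family_cells:
  assumes "definable_family Sig m n P Fam"
  shows "\<exists>p \<Psi>. drel p n \<Psi> \<and> (\<forall>B. finite B \<and> B \<subseteq> P \<longrightarrow>
    (\<exists>C. finite C \<and> C \<subseteq> Rn p \<and>
      (\<forall>X x. fam_set n Fam B X \<and> X \<subseteq> Rn n \<and> x \<in> X \<longrightarrow>
        (\<exists>c\<in>C. \<Psi> c x \<and> (\<forall>y\<in>Rn n. \<Psi> c y \<longrightarrow> y \<in> X)))))"
proof -
  have fam: "P \<in> Sig m" "Fam \<in> Sig (m + n)" using assms by (auto simp: definable_family_def)
  have P: "P \<subseteq> Rn m" using Sig_length[OF fam(1)] by (auto simp: Rn_def)
  obtain p \<Psi> where \<Psi>: "drel p n \<Psi>" and cells: "\<forall>B. finite B \<and> B \<subseteq> Rn m \<longrightarrow>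
    (\<exists>C. finite C \<and> C \<subseteq> Rn p \<and> (\<forall>x\<in>Rn n. \<exists>c\<in>C. \<Psi> c x) \<and>
      (\<forall>c\<in>C. \<forall>b\<in>B. (\<forall>x\<in>Rn n. \<Psi> c x \<longrightarrow> b @ x \<in> Fam) \<or> (\<forall>x\<in>Rn n. \<Psi> c x \<longrightarrow> b @ x \<notin> Fam)))"
    using cell_cover[OF drel_Sig[OF fam(2)]] by (elim exE conjE) (rule that)
  show ?thesis
  proof (intro exI[of _ p] exI[of _ \<Psi>] conjI \<Psi> allI impI)
    fix B assume B: "finite B \<and> B \<subseteq> P"
    then have "finite B \<and> B \<subseteq> Rn m" using P by blast
    from cells[THEN spec, THEN mp, OF this]
    obtain C where C: "finite C" "C \<subseteq> Rn p" "\<forall>x\<in>Rn n. \<exists>c\<in>C. \<Psi> c x"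
      "\<forall>c\<in>C. \<forall>b\<in>B. (\<forall>x\<in>Rn n. \<Psi> c x \<longrightarrow> b @ x \<in> Fam) \<or> (\<forall>x\<in>Rn n. \<Psi> c x \<longrightarrow> b @ x \<notin> Fam)"
      by (elim exE conjE) (rule that)
    show "\<exists>C. finite C \<and> C \<subseteq> Rn p \<and>
      (\<forall>X x. fam_set n Fam B X \<and> X \<subseteq> Rn n \<and> x \<in> X \<longrightarrow>
        (\<exists>c\<in>C. \<Psi> c x \<and> (\<forall>y\<in>Rn n. \<Psi> c y \<longrightarrow> y \<in> X)))"
    proof (intro exI[of _ C] conjI C(1,2) allI impI)
      fix X x assume X: "fam_set n Fam B X \<and> X \<subseteq> Rn n \<and> x \<in> X"
      then obtain c where c: "c \<in> C" "\<Psi> c x" using C(3) by blast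
      have "{y \<in> Rn n. \<Psi> c y} \<subseteq> X \<or> {y \<in> Rn n. \<Psi> c y} \<inter> X = {}"
        by (rule bool_alg_uncrossed[of X n Fam B]) (use X C(4) c(1) in \<open>auto simp: fam_set_def\<close>)
      then have "{y \<in> Rn n. \<Psi> c y} \<subseteq> X" using X c(2) by blast
      then show "\<exists>c\<in>C. \<Psi> c x \<and> (\<forall>y\<in>Rn n. \<Psi> c y \<longrightarrow> y \<in> X)" using c by blast
    qed
  qed
qed

end

section \<open>Assembly of the exponent and the constant\<close>

theorem theorem2p16:
  fixes Sig :: "nat \<Rightarrow> real list set set"
    and n mA mB :: nat
    and A FamA B FamB :: "real list set"
  assumes "o_minimal_expansion Sig"
    and "polynomially_bounded Sig"
    and "definable_family Sig mA n A FamA"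
    and "definable_family Sig mB (Suc n) B FamB"
  shows "\<exists>N::nat. N > 0 \<and>
    (\<forall>A' B' B''. finite A' \<and> A' \<subseteq> A \<and> finite B' \<and> B' \<subseteq> B \<and> finite B'' \<and> B'' \<subseteq> B \<longrightarrow>
      (\<exists>c::real. \<forall>S F G f g.
         fam_set n FamA A' S \<and> closed_Rn n S \<and> bounded_Rn n S \<and>
         fam_set (Suc n) FamB B' F \<and> fam_set (Suc n) FamB B'' G \<and>
         definable_fun Sig n f \<and> definable_fun Sig n g \<and>
         F = graph_on n f \<and> G = graph_on n g \<and>
         continuous_on_Rn n S f \<and> continuous_on_Rn n S g \<and>
         (\<forall>x\<in>S. f x = 0 \<longrightarrow> g x = 0)
         \<longrightarrow> (\<forall>x\<in>S. \<bar>g x\<bar> ^ N \<le> c * \<bar>f x\<bar>)))"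
proof -
  interpret o_minimal Sig
    using assms(1) by unfold_locales (simp_all add: o_minimal_expansion_def)
  obtain p \<Psi> where \<Psi>: "drel p n \<Psi>" and cellsA: "\<forall>A'. finite A' \<and> A' \<subseteq> A \<longrightarrow>
    (\<exists>C. finite C \<and> C \<subseteq> Rn p \<and>
      (\<forall>X x. fam_set n FamA A' X \<and> X \<subseteq> Rn n \<and> x \<in> X \<longrightarrow>
        (\<exists>c\<in>C. \<Psi> c x \<and> (\<forall>y\<in>Rn n. \<Psi> c y \<longrightarrow> y \<in> X))))"
    using family_cells[OF assms(3)] by (elim exE conjE) (rule that)
  obtain q \<Phi> where \<Phi>: "drel q (Suc n) \<Phi>" and cellsB: "\<forall>B'. finite B' \<and> B' \<subseteq> B \<longrightarrow>
    (\<exists>C. finite C \<and> C \<subseteq> Rn q \<and>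
      (\<forall>X x. fam_set (Suc n) FamB B' X \<and> X \<subseteq> Rn (Suc n) \<and> x \<in> X \<longrightarrow>
        (\<exists>c\<in>C. \<Phi> c x \<and> (\<forall>y\<in>Rn (Suc n). \<Phi> c y \<longrightarrow> y \<in> X))))"
    using family_cells[OF assms(4)] by (elim exE conjE) (rule that)
  \<comment> \<open>The parameter \<open>k\<close> concatenates those of one cell in
    \<open>S\<close>, one in the graph of \<open>f\<close> and one in the graph of \<open>g\<close>.
    Only \<open>\<Psi>\<close> and \<open>\<Phi>\<close> enter this family, so its exponent depends
    on the two given families alone.\<close>
  define W where "W k y z \<longleftrightarrow> (\<exists>x\<in>Rn n. \<Psi> (take p k) x \<and> \<Phi> (take q (drop p k)) (x @ [y]) \<and>
      \<Phi> (drop (p + q) k) (x @ [z]))" for k y z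
  have dW: "dpred (\<lambda>v. W (t v) (y v) (z v))" if "dvec (p + q + q) t" "dterm y" "dterm z" for t y z
  proof -
    have t: "dvec (p + q + q) (\<lambda>v. t (\<lambda>i. v (\<sigma> i)))" for \<sigma>
      using that dterm_reindex[where \<sigma> = \<sigma>] by (auto simp: dvec_def)
    have yz: "dterm (\<lambda>v. y (\<lambda>i. v (\<sigma> i)))" "dterm (\<lambda>v. z (\<lambda>i. v (\<sigma> i)))" for \<sigma>
      using that by (simp_all add: dterm_reindex)
    show ?thesis unfolding W_def
      by (intro dpred_bex_Rn dpred_conj drel_subst[OF \<Psi>] drel_subst[OF \<Phi>] dvec_snoc yz
          dvec_take[OF t] dvec_take[OF dvec_drop[OF t]] dvec_drop[OF t] dvec_map dterm_var, simp_all) simp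
  qed
  have "\<exists>N>0. \<forall>k\<in>Rn (p + q + q). (\<exists>M. \<forall>y z. W k y z \<longrightarrow> \<bar>z\<bar> \<le> M) \<and>
      (\<forall>t>0. \<exists>\<delta>>0. \<forall>y z. W k y z \<and> t \<le> \<bar>z\<bar> \<longrightarrow> \<delta> \<le> \<bar>y\<bar>) \<longrightarrow>
      (\<exists>C. \<forall>y z. W k y z \<longrightarrow> \<bar>z\<bar> ^ N \<le> C * \<bar>y\<bar>)"
    by (rule uniform_planar_inequality[OF assms(2)]) (rule dW)
  then obtain N :: nat where N: "N > 0" and ineq: "\<forall>k\<in>Rn (p + q + q). (\<exists>M. \<forall>y z. W k y z \<longrightarrow> \<bar>z\<bar> \<le> M) \<and>
      (\<forall>t>0. \<exists>\<delta>>0. \<forall>y z. W k y z \<and> t \<le> \<bar>z\<bar> \<longrightarrow> \<delta> \<le> \<bar>y\<bar>) \<longrightarrow>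
      (\<exists>C. \<forall>y z. W k y z \<longrightarrow> \<bar>z\<bar> ^ N \<le> C * \<bar>y\<bar>)"
    by (elim exE conjE) (rule that)
  show ?thesis
  proof (intro exI[of _ N] conjI N allI impI)
    fix A' B' B''
    assume fin: "finite A' \<and> A' \<subseteq> A \<and> finite B' \<and> B' \<subseteq> B \<and> finite B'' \<and> B'' \<subseteq> B"
    have "finite A' \<and> A' \<subseteq> A" using fin by blast
    from cellsA[THEN spec, THEN mp, OF this]
    obtain C where C: "finite C" "C \<subseteq> Rn p" and C_cells: "\<forall>X x. fam_set n FamA A' X \<and>
        X \<subseteq> Rn n \<and> x \<in> X \<longrightarrow> (\<exists>c\<in>C. \<Psi> c x \<and> (\<forall>y\<in>Rn n. \<Psi> c y \<longrightarrow> y \<in> X))"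
      by (elim exE conjE) (rule that)
    have "finite B' \<and> B' \<subseteq> B" using fin by blast
    from cellsB[THEN spec, THEN mp, OF this]
    obtain C' where C': "finite C'" "C' \<subseteq> Rn q" and C'_cells: "\<forall>X x. fam_set (Suc n) FamB B' X \<and>
        X \<subseteq> Rn (Suc n) \<and> x \<in> X \<longrightarrow> (\<exists>c\<in>C'. \<Phi> c x \<and> (\<forall>y\<in>Rn (Suc n). \<Phi> c y \<longrightarrow> y \<in> X))"
      by (elim exE conjE) (rule that)
    have "finite B'' \<and> B'' \<subseteq> B" using fin by blast
    from cellsB[THEN spec, THEN mp, OF this]
    obtain C'' where C'': "finite C''" "C'' \<subseteq> Rn q" and C''_cells: "\<forall>X x. fam_set (Suc n) FamB B'' X \<and>
        X \<subseteq> Rn (Suc n) \<and> x \<in> X \<longrightarrow> (\<exists>c\<in>C''. \<Phi> c x \<and> (\<forall>y\<in>Rn (Suc n). \<Phi> c y \<longrightarrow> y \<in> X))"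
      by (elim exE conjE) (rule that)
    define D where "D = (\<lambda>(c, c', c''). c @ c' @ c'') ` (C \<times> C' \<times> C'')"
    have D: "finite D" "D \<subseteq> Rn (p + q + q)" using C C' C'' by (auto simp: D_def Rn_def subset_iff)
    \<comment> \<open>The constant has to be fixed before \<open>S\<close>, \<open>f\<close> and
      \<open>g\<close> are known; \<open>D\<close> depends only on the three finite parameter sets.
      Some triples in \<open>D\<close> may come from no admissible \<open>S\<close>,
      \<open>f\<close>, \<open>g\<close> and have no constant at all, hence the premise; over the
      others a maximum is taken.\<close>
    have "\<exists>c. \<forall>k\<in>D. (\<exists>c. \<forall>y z. W k y z \<longrightarrow> \<bar>z\<bar> ^ N \<le> c * \<bar>y\<bar>) \<longrightarrow> (\<forall>y z. W k y z \<longrightarrow> \<bar>z\<bar> ^ N \<le> c * \<bar>y\<bar>)"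
      using D(1)
    proof (induction D rule: finite_induct)
      case (insert k D)
      then obtain c where c: "\<forall>k\<in>D. (\<exists>c. \<forall>y z. W k y z \<longrightarrow> \<bar>z\<bar> ^ N \<le> c * \<bar>y\<bar>) \<longrightarrow> (\<forall>y z. W k y z \<longrightarrow> \<bar>z\<bar> ^ N \<le> c * \<bar>y\<bar>)"
        by blast
      obtain c' where c': "(\<exists>c. \<forall>y z. W k y z \<longrightarrow> \<bar>z\<bar> ^ N \<le> c * \<bar>y\<bar>) \<longrightarrow> (\<forall>y z. W k y z \<longrightarrow> \<bar>z\<bar> ^ N \<le> c' * \<bar>y\<bar>)"
        by blast
      have "a \<le> c * \<bar>y\<bar> \<Longrightarrow> a \<le> max c c' * \<bar>y\<bar>" "a \<le> c' * \<bar>y\<bar> \<Longrightarrow> a \<le> max c c' * \<bar>y\<bar>" for a y :: real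
        by (meson abs_ge_zero max.cobounded1 max.cobounded2 mult_right_mono order_trans)+
      then show ?case using c c' by (intro exI[of _ "max c c'"]) (metis insertE)
    qed simp
    then obtain c where c: "\<And>k y z. k \<in> D \<Longrightarrow> \<exists>c. \<forall>y z. W k y z \<longrightarrow> \<bar>z\<bar> ^ N \<le> c * \<bar>y\<bar> \<Longrightarrow>
        W k y z \<Longrightarrow> \<bar>z\<bar> ^ N \<le> c * \<bar>y\<bar>"
      by meson
    show "\<exists>c::real. \<forall>S F G f g.
         fam_set n FamA A' S \<and> closed_Rn n S \<and> bounded_Rn n S \<and>
         fam_set (Suc n) FamB B' F \<and> fam_set (Suc n) FamB B'' G \<and>
         definable_fun Sig n f \<and> definable_fun Sig n g \<and>
         F = graph_on n f \<and> G = graph_on n g \<and>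
         continuous_on_Rn n S f \<and> continuous_on_Rn n S g \<and>
         (\<forall>x\<in>S. f x = 0 \<longrightarrow> g x = 0)
         \<longrightarrow> (\<forall>x\<in>S. \<bar>g x\<bar> ^ N \<le> c * \<bar>f x\<bar>)"
    proof (intro exI[of _ c] allI impI ballI, elim conjE)
      fix S F G f g x
      assume S: "fam_set n FamA A' S" "closed_Rn n S" "bounded_Rn n S"
        and F: "fam_set (Suc n) FamB B' F" "F = graph_on n f"
        and G: "fam_set (Suc n) FamB B'' G" "G = graph_on n g"
        and cont: "continuous_on_Rn n S f" "continuous_on_Rn n S g"
        and zeros: "\<forall>x\<in>S. f x = 0 \<longrightarrow> g x = 0" and x: "x \<in> S"
      have SR: "S \<subseteq> Rn n" using S(2) unfolding closed_Rn_def by blast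
      have graph: "u @ [y] \<in> graph_on n h \<longleftrightarrow> y = h u" if "u \<in> Rn n" for u y h
        using that by (auto simp: graph_on_def)
      have sub: "graph_on n h \<subseteq> Rn (Suc n)" for h by (auto simp: graph_on_def Rn_def)
      have xR: "x \<in> Rn n" using x SR by blast
      obtain c1 where c1: "c1 \<in> C" "\<Psi> c1 x" "\<And>u. u \<in> Rn n \<Longrightarrow> \<Psi> c1 u \<Longrightarrow> u \<in> S"
        using C_cells[rule_format, OF conjI[OF S(1) conjI[OF SR x]]] by blast
      have "x @ [f x] \<in> F" "F \<subseteq> Rn (Suc n)" using F(2) graph[OF xR] sub by simp_all
      then obtain c2 where c2: "c2 \<in> C'" "\<Phi> c2 (x @ [f x])" "\<And>u. u \<in> Rn (Suc n) \<Longrightarrow> \<Phi> c2 u \<Longrightarrow> u \<in> graph_on n f"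
        using C'_cells[rule_format, of F "x @ [f x]"] F by blast
      have "x @ [g x] \<in> G" "G \<subseteq> Rn (Suc n)" using G(2) graph[OF xR] sub by simp_all
      then obtain c3 where c3: "c3 \<in> C''" "\<Phi> c3 (x @ [g x])" "\<And>u. u \<in> Rn (Suc n) \<Longrightarrow> \<Phi> c3 u \<Longrightarrow> u \<in> graph_on n g"
        using C''_cells[rule_format, of G "x @ [g x]"] G by blast
      define k where "k = c1 @ c2 @ c3"
      have k: "k \<in> D" using c1(1) c2(1) c3(1) by (force simp: k_def D_def)
      have "length c1 = p" "length c2 = q" using c1(1) c2(1) C(2) C'(2) by (auto simp: Rn_def)
      then have W_k: "W k y z \<longleftrightarrow> (\<exists>u\<in>Rn n. \<Psi> c1 u \<and> \<Phi> c2 (u @ [y]) \<and> \<Phi> c3 (u @ [z]))" for y z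
        by (simp add: W_def k_def)
      \<comment> \<open>Since the three cells lie inside \<open>S\<close> and the two graphs, the
        bounds valid for \<open>f\<close> and \<open>g\<close> on \<open>S\<close> pass to
        \<open>W k\<close>.\<close>
      have on_S: "\<exists>u\<in>S. y = f u \<and> z = g u" if W: "W k y z" for y z
      proof -
        obtain u where u: "u \<in> Rn n" "\<Psi> c1 u" "\<Phi> c2 (u @ [y])" "\<Phi> c3 (u @ [z])"
          using W unfolding W_k by blast
        have "u @ [y] \<in> Rn (Suc n)" "u @ [z] \<in> Rn (Suc n)" using u(1) by (auto simp: Rn_def)
        then have "y = f u" "z = g u" using c2(3)[OF _ u(3)] c3(3)[OF _ u(4)] graph[OF u(1)] by auto
        then show ?thesis using c1(3)[OF u(1,2)] by blast
      qed
      obtain M where M: "\<forall>x\<in>S. \<bar>g x\<bar> \<le> M" using continuous_on_Rn_bounded[OF S(2,3) cont(2)] by blast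
      have "\<exists>c. \<forall>y z. W k y z \<longrightarrow> \<bar>z\<bar> ^ N \<le> c * \<bar>y\<bar>"
      proof (rule ineq[THEN bspec, THEN mp, OF _ conjI])
        show "k \<in> Rn (p + q + q)" using k D(2) by blast
        show "\<exists>M. \<forall>y z. W k y z \<longrightarrow> \<bar>z\<bar> \<le> M" using M on_S by (intro exI[of _ M]) blast
        show "\<forall>t>0. \<exists>\<delta>>0. \<forall>y z. W k y z \<and> t \<le> \<bar>z\<bar> \<longrightarrow> \<delta> \<le> \<bar>y\<bar>"
        proof (intro allI impI)
          fix t :: real assume "0 < t"
          then obtain \<delta> where "0 < \<delta>" "\<forall>x\<in>S. t \<le> \<bar>g x\<bar> \<longrightarrow> \<delta> \<le> \<bar>f x\<bar>"
            using continuous_on_Rn_away_from_zero[OF S(2,3) cont zeros] by blast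
          then show "\<exists>\<delta>>0. \<forall>y z. W k y z \<and> t \<le> \<bar>z\<bar> \<longrightarrow> \<delta> \<le> \<bar>y\<bar>"
            using on_S by (intro exI[of _ \<delta>]) blast
        qed
      qed
      moreover have "W k (f x) (g x)" unfolding W_k using xR c1(2) c2(2) c3(2) by blast
      ultimately show "\<bar>g x\<bar> ^ N \<le> c * \<bar>f x\<bar>" by (rule c[OF k])
    qed
  qed
qed

end
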